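(* There exist universal constants $C_0, C_1, C_2, C_3, C_4, C_5, c, c' > 0$ such that the following holds for all integers $d \geq 1$, $M \geq 2$ with $\frac{M}{\log(M)} \geq C_0\, d\log(d)$. Draw i.i.d. random vectors $g^{(1)},\dots,g^{(M)} \sim \mathcal{N}(0, d^{-1} I_d)$ in $\mathbb{R}^d$. Let $V \subset [M]$ be a set of $\lceil C_1 d \log(d)\rceil$ distinct indices, selected once and for all from $[M]$ without replacement, independently of the vectors $g^{(i)}$ (the same $V$ is used for all $x$). Set $$\tau = C_2 \frac{\sqrt{d}\,\log(d)\log(M)}{M},$$ and for $x \in S^{d-1}$ define $$W_{\tau,x} := \{ i \in [M] : -\tau < \langle g^{(i)}, x\rangle < 0\}, \qquad S_{\tau,x} := W_{\tau,x} \cup V .$$ Then, with probability at least $1 - 3\exp(-c\, d\log(d)) - 2\exp(-c'\, d\log(M))$, the following hold simultaneously for all $x \in S^{d-1}$: (1) $C_3\, d\log(d)\log(M) \leq |S_{\tau,x}| \leq C_4\, d\log(d)\log(M)$; (2) for every $y \in S^{d-1}$ such that $\operatorname{sign}(\langle g^{(i)}, x\rangle) = \operatorname{sign}(\langle g^{(i)}, y\rangle)$ for all $i \in S_{\tau,x}$, $$\|x - y\|_2 \leq \frac{C_5\, d\log(d)\log(M)}{\sqrt{M^2 + d^2 \log^2(d)\log^2(M)}} .$$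
   Context: $\langle\cdot,\cdot\rangle$ is the standard inner product on $\mathbb{R}^d$, $\|\cdot\|_2$ is the Euclidean norm, $S^{d-1}$ is the Euclidean unit sphere of $\mathbb{R}^d$, $I_d$ is the $d\times d$ identity matrix, and $[M] = \{1,\dots,M\}$. A universal constant is a number not depending on $d$, $M$, $x$, or any other parameter. *)

theory Defs
  imports "HOL-Probability.Probability"
begin

text \<open>
  The constants of the theorem must not depend on the dimension, so \<open>\<real>\<^sup>d\<close> cannot be a type
  \<open>real ^ 'd\<close> here: its elements are the functions in \<open>{..<d} \<rightarrow>\<^sub>E UNIV\<close>, which is also the space
  of the product measure \<open>\<Pi>\<^sub>M j\<in>{..<d}. borel\<close>. The Euclidean norm is \<open>L2_set _ {..<d}\<close>.
\<close>

definition inner_vec :: "nat \<Rightarrow> (nat \<Rightarrow> real) \<Rightarrow> (nat \<Rightarrow> real) \<Rightarrow> real" where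
  "inner_vec d u v = (\<Sum>j<d. u j * v j)"

definition unit_sphere :: "nat \<Rightarrow> (nat \<Rightarrow> real) set" where
  "unit_sphere d = {x \<in> {..<d} \<rightarrow>\<^sub>E UNIV. L2_set x {..<d} = 1}"

text \<open>The law \<open>N(0, d\<^sup>-\<^sup>1 I)\<close> on \<open>\<real>\<^sup>d\<close>; note that \<open>normal_density\<close> takes the standard deviation.\<close>

definition gaussian_vec :: "nat \<Rightarrow> (nat \<Rightarrow> real) measure" where
  "gaussian_vec d = (\<Pi>\<^sub>M j\<in>{..<d}. density lborel (normal_density 0 (1 / sqrt (real d))))"

text \<open>
  The joint law of i.i.d. Gaussian vectors \<open>g 1, \<dots>, g M\<close> and of an independent random index set
  with law \<open>p\<close>.
\<close>

definition sample_space ::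
  "nat \<Rightarrow> nat \<Rightarrow> nat set pmf \<Rightarrow> ((nat \<Rightarrow> nat \<Rightarrow> real) \<times> nat set) measure" where
  "sample_space d M p = (\<Pi>\<^sub>M i\<in>{1..M}. gaussian_vec d) \<Otimes>\<^sub>M measure_pmf p"

definition W_set ::
  "nat \<Rightarrow> nat \<Rightarrow> (nat \<Rightarrow> nat \<Rightarrow> real) \<Rightarrow> real \<Rightarrow> (nat \<Rightarrow> real) \<Rightarrow> nat set" where
  "W_set d M g \<tau> x = {i \<in> {1..M}. - \<tau> < inner_vec d (g i) x \<and> inner_vec d (g i) x < 0}"

definition S_set ::
  "nat \<Rightarrow> nat \<Rightarrow> (nat \<Rightarrow> nat \<Rightarrow> real) \<Rightarrow> nat set \<Rightarrow> real \<Rightarrow> (nat \<Rightarrow> real) \<Rightarrow> nat set" where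
  "S_set d M g V \<tau> x = W_set d M g \<tau> x \<union> V"

end

theory Submission
  imports Defs
begin

text \<open>
  A point \<open>y\<close> of the sphere lies in the plane spanned by \<open>x\<close> and some unit vector \<open>u\<close> orthogonal
  to \<open>x\<close>, so that \<open>y = \<alpha> x + \<beta> u\<close> with \<open>\<beta> \<ge> 0\<close> and \<open>\<alpha>\<^sup>2 + \<beta>\<^sup>2 = 1\<close>. Call an index \<open>i\<close> a witness for
  \<open>(x, u)\<close> if \<open>- \<tau> < \<langle>g i, x\<rangle> < 0\<close>, so that \<open>i\<close> belongs to the slab set \<open>W\<close>, and if moreover
  \<open>\<langle>g i, u\<rangle>\<close> is at least \<open>1 / (2 \<surd>d)\<close>, a constant multiple of its standard deviation. If the signs
  at \<open>x\<close> and \<open>y\<close> agree at a witness, then \<open>\<alpha> \<langle>g i, x\<rangle> + \<beta> \<langle>g i, u\<rangle> < 0\<close>; this forces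
  \<open>\<alpha> > 0\<close> and \<open>\<beta> / (2 \<surd>d) < \<tau>\<close>, hence \<open>\<parallel>x - y\<parallel> \<le> 2 \<beta> \<le> 4 \<surd>d \<tau>\<close>, which is the required rate
  (lemma \<open>sign_agreement_imp_close\<close>). Everything therefore reduces to one uniform statement: with
  high probability every orthonormal pair \<open>(x, u)\<close> has at least of the order of \<open>d log d log M\<close>
  witnesses, and every slab set contains at most of that order of indices
  (\<open>uniform_slab_counts\<close>).

  For a fixed pair the count is a sum of independent indicators. The variables \<open>\<langle>g i, x\<rangle>\<close> and
  \<open>\<langle>g i, u\<rangle>\<close> are independent normal variables with standard deviation \<open>1 / \<surd>d\<close>
  (\<open>nn_integral_orthonormal_pair_normal\<close>), because a product of two equal centred normal laws is
  invariant under rotation. So \<open>i\<close> is a witness with probability of order \<open>\<surd>d \<tau>\<close>, and the expected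
  number of witnesses, of order \<open>M \<surd>d \<tau> = C2 d log d log M\<close>, is missed by a
  constant factor with probability at most \<open>exp (- k C2 d log d log M)\<close>, where \<open>k > 0\<close> is a
  constant (\<open>chernoff_count\<close>). The number of indices in a slab is controlled in the same way.

  For all pairs at once, a net of coordinatewise resolution \<open>1 / (8 M\<^sup>3)\<close> suffices: as soon as all
  coordinates of all \<open>g i\<close> are bounded by \<open>M\<close>, replacing a pair by a net point moves every inner
  product by at most \<open>\<tau> / 8\<close>. The net has at most \<open>exp (14 d log M)\<close> points (\<open>finite_net\<close>), and a
  large \<open>C2\<close> makes the Chernoff bound beat this number. The coordinates exceed \<open>M\<close> with
  probability at most \<open>3 exp (- d log d)\<close>, and this is the source of the first error term.
\<close>

section \<open>Rotation invariance of a pair of independent normal variables\<close>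

abbreviation centred_normal :: "real \<Rightarrow> real measure" where
  "centred_normal \<sigma> \<equiv> density lborel (normal_density 0 \<sigma>)"

text \<open>
  A rotation with nonzero cosine is the composition of two affine substitutions in one variable
  each, first in \<open>z\<close> for fixed \<open>w\<close>, then in \<open>w\<close> for fixed new first coordinate. The first divides
  the integral by \<open>\<bar>c\<bar>\<close> and the second multiplies it by \<open>\<bar>c\<bar>\<close>.
\<close>

lemma nn_integral_lborel_rotate:
  fixes c s :: real and G :: "real \<Rightarrow> real \<Rightarrow> ennreal"
  assumes cs: "c\<^sup>2 + s\<^sup>2 = 1" and c: "c \<noteq> 0"
  assumes G[measurable]: "case_prod G \<in> borel_measurable (borel \<Otimes>\<^sub>M borel)"
  shows "(\<integral>\<^sup>+z. \<integral>\<^sup>+w. G (c * z + s * w) (c * w - s * z) \<partial>lborel \<partial>lborel) = (\<integral>\<^sup>+z. \<integral>\<^sup>+w. G z w \<partial>lborel \<partial>lborel)"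
    (is "?L = ?R")
proof -
  have eq: "G (c * z + s * w) (c * w - s * z) = G (s * w + c * z) ((w - s * (s * w + c * z)) / c)" for z w
  proof -
    have "(w - s * (s * w + c * z)) = w * (1 - s\<^sup>2) - s * c * z"
      by (simp add: algebra_simps power2_eq_square)
    also have "1 - s\<^sup>2 = c\<^sup>2" using cs by simp
    finally have "(w - s * (s * w + c * z)) = (c * w - s * z) * c"
      by (simp add: algebra_simps power2_eq_square)
    then show ?thesis using c by (simp add: add.commute)
  qed
  have "\<bar>c\<bar> * ?L = \<bar>c\<bar> * (\<integral>\<^sup>+w. \<integral>\<^sup>+z. G (c * z + s * w) (c * w - s * z) \<partial>lborel \<partial>lborel)"
    by (subst lborel_pair.Fubini') simp_all
  also have "\<dots> = (\<integral>\<^sup>+w. \<bar>c\<bar> * (\<integral>\<^sup>+z. G (c * z + s * w) (c * w - s * z) \<partial>lborel) \<partial>lborel)"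
    by (rule nn_integral_cmult[symmetric]) simp
  also have "\<dots> = (\<integral>\<^sup>+w. \<integral>\<^sup>+p. G p ((w - s * p) / c) \<partial>lborel \<partial>lborel)"
    unfolding eq
    by (intro nn_integral_cong nn_integral_real_affine[OF _ c, symmetric]) simp
  also have "\<dots> = (\<integral>\<^sup>+p. \<integral>\<^sup>+w. G p ((w - s * p) / c) \<partial>lborel \<partial>lborel)"
    by (rule lborel_pair.Fubini') simp
  also have "\<dots> = (\<integral>\<^sup>+p. \<bar>c\<bar> * (\<integral>\<^sup>+w. G p ((s * p + c * w - s * p) / c) \<partial>lborel) \<partial>lborel)"
    by (intro nn_integral_cong nn_integral_real_affine[OF _ c]) simp
  also have "\<dots> = (\<integral>\<^sup>+p. \<bar>c\<bar> * (\<integral>\<^sup>+w. G p w \<partial>lborel) \<partial>lborel)"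
    using c by simp
  also have "\<dots> = \<bar>c\<bar> * ?R"
    by (rule nn_integral_cmult) simp
  finally show ?thesis
    using c by (simp add: ennreal_mult_cancel_left)
qed

lemma normal_density_rotate:
  assumes cs: "c\<^sup>2 + s\<^sup>2 = 1"
  shows "normal_density 0 \<sigma> (c * z + s * w) * normal_density 0 \<sigma> (c * w - s * z)
       = normal_density 0 \<sigma> z * normal_density 0 \<sigma> w"
proof -
  have "(c * z + s * w)\<^sup>2 + (c * w - s * z)\<^sup>2 = (c\<^sup>2 + s\<^sup>2) * (z\<^sup>2 + w\<^sup>2)"
    by (simp add: algebra_simps power2_eq_square)
  then have sq: "(c * z + s * w)\<^sup>2 + (c * w - s * z)\<^sup>2 = z\<^sup>2 + w\<^sup>2" using cs by simp
  have e: "exp (- a\<^sup>2 / (2 * \<sigma>\<^sup>2)) * exp (- b\<^sup>2 / (2 * \<sigma>\<^sup>2)) = exp (- (a\<^sup>2 + b\<^sup>2) / (2 * \<sigma>\<^sup>2))" for a b :: real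
    by (simp add: exp_add[symmetric] add_divide_distrib diff_divide_distrib)
  show ?thesis
    unfolding normal_density_def diff_0_right
    by (simp only: mult.assoc mult.left_commute[of "exp _"] e sq)
qed

lemma nn_integral_normal_normal:
  assumes [measurable]: "case_prod f \<in> borel_measurable (borel \<Otimes>\<^sub>M borel)"
  shows "(\<integral>\<^sup>+z. \<integral>\<^sup>+w. f z w \<partial>centred_normal \<sigma> \<partial>centred_normal \<sigma>)
    = (\<integral>\<^sup>+z. \<integral>\<^sup>+w. ennreal (normal_density 0 \<sigma> z * normal_density 0 \<sigma> w) * f z w \<partial>lborel \<partial>lborel)"
  by (simp add: nn_integral_density nn_integral_cmult[symmetric] ennreal_mult mult.assoc)

lemma nn_integral_normal_rotate_nonzero_cos:
  assumes cs: "c\<^sup>2 + s\<^sup>2 = 1" and c: "c \<noteq> 0"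
  assumes f[measurable]: "case_prod f \<in> borel_measurable (borel \<Otimes>\<^sub>M borel)"
  shows "(\<integral>\<^sup>+z. \<integral>\<^sup>+w. f (c * z + s * w) (c * w - s * z) \<partial>centred_normal \<sigma> \<partial>centred_normal \<sigma>)
       = (\<integral>\<^sup>+z. \<integral>\<^sup>+w. f z w \<partial>centred_normal \<sigma> \<partial>centred_normal \<sigma>)"
  using nn_integral_lborel_rotate[OF cs c,
      of "\<lambda>z w. ennreal (normal_density 0 \<sigma> z * normal_density 0 \<sigma> w) * f z w"]
  by (simp add: nn_integral_normal_normal normal_density_rotate[OF cs])

text \<open>
  The product of the two densities depends on \<open>z\<^sup>2 + w\<^sup>2\<close> only, so the invariance of Lebesgue measure
  carries over. A quarter turn, where the cosine vanishes, is performed as two turns by an eighth.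
\<close>

proposition nn_integral_normal_rotate:
  assumes cs: "c\<^sup>2 + s\<^sup>2 = 1"
  assumes f[measurable]: "case_prod f \<in> borel_measurable (borel \<Otimes>\<^sub>M borel)"
  shows "(\<integral>\<^sup>+z. \<integral>\<^sup>+w. f (c * z + s * w) (c * w - s * z) \<partial>centred_normal \<sigma> \<partial>centred_normal \<sigma>)
       = (\<integral>\<^sup>+z. \<integral>\<^sup>+w. f z w \<partial>centred_normal \<sigma> \<partial>centred_normal \<sigma>)"
proof (cases "c = 0")
  case False
  then show ?thesis by (rule nn_integral_normal_rotate_nonzero_cos[OF cs _ f])
next
  case True
  define r where "r = 1 / sqrt 2"
  have r2: "r * r = 1 / 2" by (simp add: r_def)
  have r0: "r \<noteq> 0" by (simp add: r_def)
  have s2: "s * s = 1" using cs True by (simp add: power2_eq_square)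
  have rs: "r\<^sup>2 + (s * r)\<^sup>2 = 1"
    using r2 s2 by (simp add: power2_eq_square algebra_simps)
  define h where "h z w = f (r * z + s * r * w) (r * w - s * r * z)" for z w
  have [measurable]: "case_prod h \<in> borel_measurable (borel \<Otimes>\<^sub>M borel)"
    unfolding h_def by measurable
  have A: "r * (r * z + s * r * w) + s * r * (r * w - s * r * z) = s * w" for z w
  proof -
    have "r * (r * z + s * r * w) + s * r * (r * w - s * r * z) = (r * r) * z - (r * r) * (s * s) * z + 2 * (r * r) * (s * w)"
      by (simp add: algebra_simps)
    then show ?thesis by (simp add: r2 s2)
  qed
  have B: "r * (r * w - s * r * z) - s * r * (r * z + s * r * w) = - (s * z)" for z w
  proof -
    have "r * (r * w - s * r * z) - s * r * (r * z + s * r * w) = (r * r) * w - (r * r) * (s * s) * w - 2 * (r * r) * (s * z)"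
      by (simp add: algebra_simps)
    then show ?thesis by (simp add: r2 s2)
  qed
  have "f (c * z + s * w) (c * w - s * z) = h (r * z + s * r * w) (r * w - s * r * z)" for z w
    unfolding h_def A B using True by simp
  then have "(\<integral>\<^sup>+z. \<integral>\<^sup>+w. f (c * z + s * w) (c * w - s * z) \<partial>centred_normal \<sigma> \<partial>centred_normal \<sigma>)
     = (\<integral>\<^sup>+z. \<integral>\<^sup>+w. h z w \<partial>centred_normal \<sigma> \<partial>centred_normal \<sigma>)"
    using nn_integral_normal_rotate_nonzero_cos[OF rs r0, of h \<sigma>] by simp
  also have "\<dots> = (\<integral>\<^sup>+z. \<integral>\<^sup>+w. f z w \<partial>centred_normal \<sigma> \<partial>centred_normal \<sigma>)"
    unfolding h_def by (rule nn_integral_normal_rotate_nonzero_cos[OF rs r0 f])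
  finally show ?thesis .
qed

text \<open>
  Two noises \<open>a z + b w\<close> merge into a single one of variance \<open>r\<^sup>2 = a\<^sup>2 + b\<^sup>2\<close>, while a second linear
  form \<open>p z + q w\<close> splits into a part along the merged variable and a part independent of it. Here
  \<open>(u, v)\<close> is the direction of \<open>(a, b)\<close>; for \<open>a = b = 0\<close> any direction does.
\<close>

lemma nn_integral_normal_combine:
  fixes a b :: real
  obtains r u v where "r \<ge> 0" "r\<^sup>2 = a\<^sup>2 + b\<^sup>2"
    "\<And>f p q. f \<in> borel_measurable (borel \<Otimes>\<^sub>M borel) \<Longrightarrow>
       (\<integral>\<^sup>+z. \<integral>\<^sup>+w. f (a * z + b * w, p * z + q * w) \<partial>centred_normal \<sigma> \<partial>centred_normal \<sigma>)
     = (\<integral>\<^sup>+z. \<integral>\<^sup>+w. f (r * z, (p * u + q * v) * z + (q * u - p * v) * w)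
          \<partial>centred_normal \<sigma> \<partial>centred_normal \<sigma>)"
    "r * u = a" "r * v = b" "u\<^sup>2 + v\<^sup>2 = 1"
proof -
  define r where "r = sqrt (a\<^sup>2 + b\<^sup>2)"
  have r2: "r\<^sup>2 = a\<^sup>2 + b\<^sup>2" by (simp add: r_def)
  have "\<exists>u v. r * u = a \<and> r * v = b \<and> u\<^sup>2 + v\<^sup>2 = 1"
  proof (cases "r = 0")
    case True
    then have "a = 0" "b = 0" using r2 by (simp_all add: sum_power2_eq_zero_iff)
    then show ?thesis using True by (intro exI[of _ 1] exI[of _ 0]) simp
  next
    case False
    then have "(a / r)\<^sup>2 + (b / r)\<^sup>2 = 1"
      by (simp add: power_divide add_divide_distrib[symmetric] r2[symmetric])
    then show ?thesis using False by (intro exI[of _ "a / r"] exI[of _ "b / r"]) simp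
  qed
  then obtain u v where uv: "r * u = a" "r * v = b" "u\<^sup>2 + v\<^sup>2 = 1" by blast
  have main: "(\<integral>\<^sup>+z. \<integral>\<^sup>+w. f (a * z + b * w, p * z + q * w) \<partial>centred_normal \<sigma> \<partial>centred_normal \<sigma>)
     = (\<integral>\<^sup>+z. \<integral>\<^sup>+w. f (r * z, (p * u + q * v) * z + (q * u - p * v) * w)
          \<partial>centred_normal \<sigma> \<partial>centred_normal \<sigma>)"
    if [measurable]: "f \<in> borel_measurable (borel \<Otimes>\<^sub>M borel)" for f p q
  proof -
    have 1: "r * (u * z + v * w) = a * z + b * w" for z w
      by (simp add: uv(1,2)[symmetric] algebra_simps)
    have 2: "(p * u + q * v) * (u * z + v * w) + (q * u - p * v) * (u * w - v * z) = p * z + q * w" for z w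
    proof -
      have "(p * u + q * v) * (u * z + v * w) + (q * u - p * v) * (u * w - v * z)
         = (u\<^sup>2 + v\<^sup>2) * (p * z + q * w)"
        by (simp add: algebra_simps power2_eq_square)
      then show ?thesis by (simp add: uv)
    qed
    show ?thesis
      using nn_integral_normal_rotate[OF uv(3),
          of "\<lambda>z w. f (r * z, (p * u + q * v) * z + (q * u - p * v) * w)" \<sigma>]
      by (simp add: 1 2)
  qed
  show ?thesis
    by (rule that[of r u v]) (use uv r2 main in \<open>simp_all add: r_def\<close>)
qed

section \<open>The joint law of two linear forms in a Gaussian vector\<close>

lemma prob_space_centred_normal: "\<sigma> > 0 \<Longrightarrow> prob_space (centred_normal \<sigma>)"
  by (rule prob_space_normal_density)

text \<open>
  The form is that of a Cholesky factorisation of the Gram matrix of \<open>(x, y)\<close>: the two linear forms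
  have the joint law of \<open>(\<alpha> z, \<beta> z + \<gamma> w)\<close>. Restricting orthonormal vectors to their first \<open>n\<close>
  coordinates destroys orthonormality, and this is why the induction on \<open>n\<close> needs arbitrary
  vectors. In the induction step the new coordinate is first merged into the variable \<open>z\<close>; what
  remains of it in the second form, with coefficient \<open>\<delta>\<close>, is then merged into \<open>w\<close>.
\<close>

lemma nn_integral_linear_pair_normal:
  fixes x y :: "nat \<Rightarrow> real"
  assumes \<sigma>: "\<sigma> > 0"
  shows "\<exists>\<alpha> \<beta> \<gamma>. \<alpha> \<ge> 0 \<and> \<gamma> \<ge> 0 \<and> \<alpha>\<^sup>2 = (\<Sum>j<n. (x j)\<^sup>2) \<and> \<alpha> * \<beta> = (\<Sum>j<n. x j * y j)
    \<and> \<beta>\<^sup>2 + \<gamma>\<^sup>2 = (\<Sum>j<n. (y j)\<^sup>2) \<and>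
    (\<forall>f \<in> borel_measurable (borel \<Otimes>\<^sub>M borel).
      (\<integral>\<^sup>+g. f (\<Sum>j<n. g j * x j, \<Sum>j<n. g j * y j) \<partial>(\<Pi>\<^sub>M j\<in>{..<n}. centred_normal \<sigma>))
      = (\<integral>\<^sup>+z. \<integral>\<^sup>+w. f (\<alpha> * z, \<beta> * z + \<gamma> * w) \<partial>centred_normal \<sigma> \<partial>centred_normal \<sigma>))"
proof -
  interpret N: prob_space "centred_normal \<sigma>" by (rule prob_space_centred_normal[OF \<sigma>])
  interpret product_sigma_finite "\<lambda>_::nat. centred_normal \<sigma>" by standard
  interpret NN: pair_sigma_finite "centred_normal \<sigma>" "centred_normal \<sigma>" by standard
  have N1: "emeasure (centred_normal \<sigma>) UNIV = 1"
    using N.emeasure_space_1 by simp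
  show ?thesis
  proof (induction n)
    case 0
    show ?case
      by (intro exI[of _ 0] conjI) (simp_all add: PiM_empty N1)
  next
    case (Suc n)
    then obtain \<alpha> \<beta> \<gamma> where ge0: "\<alpha> \<ge> 0" "\<gamma> \<ge> 0"
      and gram: "\<alpha>\<^sup>2 = (\<Sum>j<n. (x j)\<^sup>2)" "\<alpha> * \<beta> = (\<Sum>j<n. x j * y j)"
        "\<beta>\<^sup>2 + \<gamma>\<^sup>2 = (\<Sum>j<n. (y j)\<^sup>2)"
      and IH: "\<And>f. f \<in> borel_measurable (borel \<Otimes>\<^sub>M borel) \<Longrightarrow>
      (\<integral>\<^sup>+g. f (\<Sum>j<n. g j * x j, \<Sum>j<n. g j * y j) \<partial>(\<Pi>\<^sub>M j\<in>{..<n}. centred_normal \<sigma>))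
      = (\<integral>\<^sup>+z. \<integral>\<^sup>+w. f (\<alpha> * z, \<beta> * z + \<gamma> * w) \<partial>centred_normal \<sigma> \<partial>centred_normal \<sigma>)"
      by blast
    obtain r u v where r: "r \<ge> 0" "r\<^sup>2 = \<alpha>\<^sup>2 + (x n)\<^sup>2" "r * u = \<alpha>" "r * v = x n" "u\<^sup>2 + v\<^sup>2 = 1"
      and rot1: "\<And>f p q. f \<in> borel_measurable (borel \<Otimes>\<^sub>M borel) \<Longrightarrow>
       (\<integral>\<^sup>+z. \<integral>\<^sup>+w. f (\<alpha> * z + x n * w, p * z + q * w) \<partial>centred_normal \<sigma> \<partial>centred_normal \<sigma>)
     = (\<integral>\<^sup>+z. \<integral>\<^sup>+w. f (r * z, (p * u + q * v) * z + (q * u - p * v) * w)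
          \<partial>centred_normal \<sigma> \<partial>centred_normal \<sigma>)"
      by (rule nn_integral_normal_combine[of \<alpha> "x n" \<sigma>]) blast
    define \<beta>' where "\<beta>' = \<beta> * u + y n * v"
    define \<delta> where "\<delta> = y n * u - \<beta> * v"
    obtain t where t: "t \<ge> 0" "t\<^sup>2 = \<gamma>\<^sup>2 + \<delta>\<^sup>2"
      and rot2: "\<And>f. f \<in> borel_measurable (borel \<Otimes>\<^sub>M borel) \<Longrightarrow>
       (\<integral>\<^sup>+z. \<integral>\<^sup>+w. f (\<gamma> * z + \<delta> * w, 0 :: real) \<partial>centred_normal \<sigma> \<partial>centred_normal \<sigma>)
     = (\<integral>\<^sup>+z. \<integral>\<^sup>+w. f (t * z, 0 :: real) \<partial>centred_normal \<sigma> \<partial>centred_normal \<sigma>)"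
    proof (rule nn_integral_normal_combine[of \<gamma> \<delta> \<sigma>])
      fix r u v
      assume a: "0 \<le> r" "r\<^sup>2 = \<gamma>\<^sup>2 + \<delta>\<^sup>2"
        and b: "\<And>f p q. f \<in> borel_measurable (borel \<Otimes>\<^sub>M borel) \<Longrightarrow>
       (\<integral>\<^sup>+z. \<integral>\<^sup>+w. f (\<gamma> * z + \<delta> * w, p * z + q * w) \<partial>centred_normal \<sigma> \<partial>centred_normal \<sigma>)
     = (\<integral>\<^sup>+z. \<integral>\<^sup>+w. f (r * z, (p * u + q * v) * z + (q * u - p * v) * w)
          \<partial>centred_normal \<sigma> \<partial>centred_normal \<sigma>)"
      have "(\<integral>\<^sup>+z. \<integral>\<^sup>+w. f (\<gamma> * z + \<delta> * w, 0 :: real) \<partial>centred_normal \<sigma> \<partial>centred_normal \<sigma>)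
        = (\<integral>\<^sup>+z. \<integral>\<^sup>+w. f (r * z, 0 :: real) \<partial>centred_normal \<sigma> \<partial>centred_normal \<sigma>)"
        if "f \<in> borel_measurable (borel \<Otimes>\<^sub>M borel)" for f
        using b[OF that, of 0 0] by (simp only: mult_zero_left add_0_left diff_self)
      with a show thesis by (rule that)
    qed
    have step: "(\<integral>\<^sup>+g. f (\<Sum>j<Suc n. g j * x j, \<Sum>j<Suc n. g j * y j) \<partial>(\<Pi>\<^sub>M j\<in>{..<Suc n}. centred_normal \<sigma>))
      = (\<integral>\<^sup>+z. \<integral>\<^sup>+w. f (r * z, \<beta>' * z + t * w) \<partial>centred_normal \<sigma> \<partial>centred_normal \<sigma>)"
      if f[measurable]: "f \<in> borel_measurable (borel \<Otimes>\<^sub>M borel)" for f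
    proof -
      have up: "(\<Sum>j<n. (g(n := w)) j * a j) = (\<Sum>j<n. g j * a j)" for g a :: "nat \<Rightarrow> real" and w
        by (intro sum.cong) auto
      have "(\<integral>\<^sup>+g. f (\<Sum>j<Suc n. g j * x j, \<Sum>j<Suc n. g j * y j) \<partial>(\<Pi>\<^sub>M j\<in>{..<Suc n}. centred_normal \<sigma>))
        = (\<integral>\<^sup>+g. \<integral>\<^sup>+w. f ((\<Sum>j<n. g j * x j) + w * x n, (\<Sum>j<n. g j * y j) + w * y n) \<partial>centred_normal \<sigma>
              \<partial>(\<Pi>\<^sub>M j\<in>{..<n}. centred_normal \<sigma>))"
        unfolding lessThan_Suc
        by (subst product_nn_integral_insert) (simp_all add: up add.commute del: fun_upd_apply, simp add: add.commute)
      also have "\<dots> = (\<integral>\<^sup>+z. \<integral>\<^sup>+w. \<integral>\<^sup>+k. f (\<alpha> * z + k * x n, \<beta> * z + \<gamma> * w + k * y n)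
          \<partial>centred_normal \<sigma> \<partial>centred_normal \<sigma> \<partial>centred_normal \<sigma>)"
        using IH[of "\<lambda>q. \<integral>\<^sup>+k. f (fst q + k * x n, snd q + k * y n) \<partial>centred_normal \<sigma>"] by simp
      also have "\<dots> = (\<integral>\<^sup>+w. \<integral>\<^sup>+z. \<integral>\<^sup>+k. f (\<alpha> * z + k * x n, \<beta> * z + \<gamma> * w + k * y n)
          \<partial>centred_normal \<sigma> \<partial>centred_normal \<sigma> \<partial>centred_normal \<sigma>)"
        by (rule NN.Fubini'[symmetric]) simp
      also have "\<dots> = (\<integral>\<^sup>+w. \<integral>\<^sup>+z. \<integral>\<^sup>+k. f (r * z, \<gamma> * w + (\<beta>' * z + \<delta> * k))
          \<partial>centred_normal \<sigma> \<partial>centred_normal \<sigma> \<partial>centred_normal \<sigma>)"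
      proof (rule nn_integral_cong)
        fix w
        show "(\<integral>\<^sup>+z. \<integral>\<^sup>+k. f (\<alpha> * z + k * x n, \<beta> * z + \<gamma> * w + k * y n) \<partial>centred_normal \<sigma> \<partial>centred_normal \<sigma>)
          = (\<integral>\<^sup>+z. \<integral>\<^sup>+k. f (r * z, \<gamma> * w + (\<beta>' * z + \<delta> * k)) \<partial>centred_normal \<sigma> \<partial>centred_normal \<sigma>)"
          using rot1[of "\<lambda>q. f (fst q, \<gamma> * w + snd q)" \<beta> "y n"]
          by (simp add: \<beta>'_def \<delta>_def ac_simps)
      qed
      also have "\<dots> = (\<integral>\<^sup>+z. \<integral>\<^sup>+w. \<integral>\<^sup>+k. f (r * z, \<gamma> * w + (\<beta>' * z + \<delta> * k))
          \<partial>centred_normal \<sigma> \<partial>centred_normal \<sigma> \<partial>centred_normal \<sigma>)"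
        by (rule NN.Fubini') simp
      also have "\<dots> = (\<integral>\<^sup>+z. \<integral>\<^sup>+w. \<integral>\<^sup>+k. f (r * z, \<beta>' * z + t * w) \<partial>centred_normal \<sigma> \<partial>centred_normal \<sigma> \<partial>centred_normal \<sigma>)"
      proof (rule nn_integral_cong)
        fix z
        show "(\<integral>\<^sup>+w. \<integral>\<^sup>+k. f (r * z, \<gamma> * w + (\<beta>' * z + \<delta> * k)) \<partial>centred_normal \<sigma> \<partial>centred_normal \<sigma>)
          = (\<integral>\<^sup>+w. \<integral>\<^sup>+k. f (r * z, \<beta>' * z + t * w) \<partial>centred_normal \<sigma> \<partial>centred_normal \<sigma>)"
          using rot2[of "\<lambda>q. f (r * z, \<beta>' * z + fst q)"] by (simp add: add.left_commute)
      qed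
      also have "\<dots> = (\<integral>\<^sup>+z. \<integral>\<^sup>+w. f (r * z, \<beta>' * z + t * w) \<partial>centred_normal \<sigma> \<partial>centred_normal \<sigma>)"
        by (simp add: N1)
      finally show ?thesis .
    qed
    have "r * \<beta>' = \<beta> * (r * u) + y n * (r * v)"
      by (simp add: \<beta>'_def algebra_simps)
    also have "\<dots> = (\<Sum>j<Suc n. x j * y j)"
      by (simp add: r gram(2)[symmetric])
    finally have g2: "r * \<beta>' = (\<Sum>j<Suc n. x j * y j)" .
    have "\<beta>'\<^sup>2 + \<delta>\<^sup>2 = (u\<^sup>2 + v\<^sup>2) * (\<beta>\<^sup>2 + (y n)\<^sup>2)"
      by (simp add: \<beta>'_def \<delta>_def algebra_simps power2_eq_square)
    then have g3: "\<beta>'\<^sup>2 + t\<^sup>2 = (\<Sum>j<Suc n. (y j)\<^sup>2)"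
      by (simp add: t(2) r(5) gram(3)[symmetric])
    show ?case
      by (intro exI[of _ r] exI[of _ \<beta>'] exI[of _ t] conjI ballI step)
        (use r(1,2) t(1) g2 g3 gram(1) in simp_all)
  qed
qed

text \<open>
  The Gram matrix of an orthonormal pair is the identity, and the identity is its only triangular
  factor with a nonnegative diagonal.
\<close>

proposition nn_integral_orthonormal_pair_normal:
  fixes x y :: "nat \<Rightarrow> real"
  assumes \<sigma>: "\<sigma> > 0"
    and on: "(\<Sum>j<n. (x j)\<^sup>2) = 1" "(\<Sum>j<n. x j * y j) = 0" "(\<Sum>j<n. (y j)\<^sup>2) = 1"
    and f: "f \<in> borel_measurable (borel \<Otimes>\<^sub>M borel)"
  shows "(\<integral>\<^sup>+g. f (\<Sum>j<n. g j * x j, \<Sum>j<n. g j * y j) \<partial>(\<Pi>\<^sub>M j\<in>{..<n}. centred_normal \<sigma>))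
      = (\<integral>\<^sup>+z. \<integral>\<^sup>+w. f (z, w) \<partial>centred_normal \<sigma> \<partial>centred_normal \<sigma>)"
proof -
  obtain \<alpha> \<beta> \<gamma> where ge0: "\<alpha> \<ge> 0" "\<gamma> \<ge> 0"
    and gram: "\<alpha>\<^sup>2 = (\<Sum>j<n. (x j)\<^sup>2)" "\<alpha> * \<beta> = (\<Sum>j<n. x j * y j)" "\<beta>\<^sup>2 + \<gamma>\<^sup>2 = (\<Sum>j<n. (y j)\<^sup>2)"
    and eq: "(\<integral>\<^sup>+g. f (\<Sum>j<n. g j * x j, \<Sum>j<n. g j * y j) \<partial>(\<Pi>\<^sub>M j\<in>{..<n}. centred_normal \<sigma>))
      = (\<integral>\<^sup>+z. \<integral>\<^sup>+w. f (\<alpha> * z, \<beta> * z + \<gamma> * w) \<partial>centred_normal \<sigma> \<partial>centred_normal \<sigma>)"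
    using nn_integral_linear_pair_normal[OF \<sigma>, where n = n and x = x and y = y] f by blast
  have "\<alpha> = 1" using gram(1) on(1) ge0(1) by (simp add: power2_eq_1_iff)
  moreover have "\<beta> = 0" using gram(2) on(2) calculation by simp
  moreover have "\<gamma> = 1" using gram(3) on(3) ge0(2) calculation by (simp add: power2_eq_1_iff)
  ultimately show ?thesis using eq by simp
qed

lemma measure_orthonormal_pair_normal:
  fixes x y :: "nat \<Rightarrow> real"
  assumes \<sigma>: "\<sigma> > 0"
    and on: "(\<Sum>j<n. (x j)\<^sup>2) = 1" "(\<Sum>j<n. x j * y j) = 0" "(\<Sum>j<n. (y j)\<^sup>2) = 1"
    and [measurable]: "A \<in> sets borel" "B \<in> sets borel"
  shows "measure (\<Pi>\<^sub>M j\<in>{..<n}. centred_normal \<sigma>)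
      {g \<in> space (\<Pi>\<^sub>M j\<in>{..<n}. centred_normal \<sigma>). (\<Sum>j<n. g j * x j) \<in> A \<and> (\<Sum>j<n. g j * y j) \<in> B}
    = measure (centred_normal \<sigma>) A * measure (centred_normal \<sigma>) B"
proof -
  let ?P = "\<Pi>\<^sub>M j\<in>{..<n}. centred_normal \<sigma>"
  interpret N: prob_space "centred_normal \<sigma>" by (rule prob_space_centred_normal[OF \<sigma>])
  have "emeasure ?P {g \<in> space ?P. (\<Sum>j<n. g j * x j) \<in> A \<and> (\<Sum>j<n. g j * y j) \<in> B}
    = (\<integral>\<^sup>+g. indicator {g \<in> space ?P. (\<Sum>j<n. g j * x j) \<in> A \<and> (\<Sum>j<n. g j * y j) \<in> B} g \<partial>?P)"
    by (subst nn_integral_indicator) simp_all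
  also have "\<dots> = (\<integral>\<^sup>+g. indicator (A \<times> B) (\<Sum>j<n. g j * x j, \<Sum>j<n. g j * y j) \<partial>?P)"
    by (intro nn_integral_cong) (auto simp: indicator_def)
  also have "\<dots> = (\<integral>\<^sup>+z. \<integral>\<^sup>+w. indicator (A \<times> B) (z, w) \<partial>centred_normal \<sigma> \<partial>centred_normal \<sigma>)"
    by (rule nn_integral_orthonormal_pair_normal[OF \<sigma> on]) simp
  also have "\<dots> = (\<integral>\<^sup>+z. indicator A z * emeasure (centred_normal \<sigma>) B \<partial>centred_normal \<sigma>)"
    by (simp add: indicator_times nn_integral_cmult)
  also have "\<dots> = emeasure (centred_normal \<sigma>) A * emeasure (centred_normal \<sigma>) B"
    by (simp add: nn_integral_multc)
  finally show ?thesis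
    unfolding measure_def by (simp add: enn2real_mult)
qed

section \<open>Concentration of counts and normal probabilities\<close>

text \<open>
  Markov's inequality for \<open>exp (s * count)\<close>. The sign of \<open>s\<close> decides which tail is estimated, so that
  both one-sided bounds below are instances. An additive (Hoeffding) bound would not be enough, as
  the expected counts are tiny compared with the number of indices.
\<close>

lemma chernoff_count:
  fixes s k :: real
  assumes I: "finite I" and N: "prob_space N" and A[measurable]: "A \<in> sets N"
  shows "measure (\<Pi>\<^sub>M i\<in>I. N) {g \<in> space (\<Pi>\<^sub>M i\<in>I. N). s * k \<le> s * real (card {i \<in> I. g i \<in> A})}
    \<le> exp (real (card I) * (measure N A * (exp s - 1)) - s * k)"
proof -
  interpret N: prob_space N by fact
  interpret P: product_prob_space "\<lambda>_. N" I by standard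
  let ?P = "\<Pi>\<^sub>M i\<in>I. N"
  let ?p = "measure N A"
  let ?h = "\<lambda>x. ennreal (exp (s * indicator A x))"
  have card_eq: "real (card {i \<in> I. g i \<in> A}) = (\<Sum>i\<in>I. indicator A (g i))" for g
    using I by (simp add: indicator_def sum.If_cases Int_def)
  have [measurable]: "(\<lambda>g. real (card {i \<in> I. g i \<in> A})) \<in> borel_measurable ?P"
    unfolding card_eq by measurable
  have factor: "(\<integral>\<^sup>+x. ?h x \<partial>N) \<le> ennreal (exp (?p * (exp s - 1)))"
  proof -
    have "(\<integral>\<^sup>+x. ?h x \<partial>N) = (\<integral>\<^sup>+x. ennreal (exp s) * indicator A x + indicator (space N - A) x \<partial>N)"
      by (intro nn_integral_cong) (auto simp: indicator_def)
    also have "\<dots> = ennreal (exp s) * emeasure N A + emeasure N (space N - A)"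
      by (subst nn_integral_add) (simp_all add: nn_integral_cmult)
    also have "\<dots> = ennreal (exp s * ?p + (1 - ?p))"
      by (simp add: N.emeasure_eq_measure N.prob_compl ennreal_mult'[symmetric] ennreal_plus[symmetric] del: ennreal_plus)
    also have "\<dots> \<le> ennreal (exp (?p * (exp s - 1)))"
      by (rule ennreal_leI) (use exp_ge_add_one_self[of "?p * (exp s - 1)"] in \<open>simp add: algebra_simps\<close>)
    finally show ?thesis .
  qed
  have "emeasure ?P {g \<in> space ?P. s * k \<le> s * real (card {i \<in> I. g i \<in> A})}
    = (\<integral>\<^sup>+g. indicator {g \<in> space ?P. s * k \<le> s * real (card {i \<in> I. g i \<in> A})} g \<partial>?P)"
    by (subst nn_integral_indicator) simp_all
  also have "\<dots> \<le> (\<integral>\<^sup>+g. ennreal (exp (- s * k)) * (\<Prod>i\<in>I. ?h (g i)) \<partial>?P)"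
  proof (rule nn_integral_mono)
    fix g
    have "ennreal (exp (- s * k)) * (\<Prod>i\<in>I. ?h (g i)) = ennreal (exp (s * real (card {i \<in> I. g i \<in> A}) - s * k))"
      using I by (simp add: card_eq prod_ennreal exp_sum[symmetric] sum_distrib_left[symmetric]
          ennreal_mult'[symmetric] exp_add[symmetric])
    then show "indicator {g \<in> space ?P. s * k \<le> s * real (card {i \<in> I. g i \<in> A})} g
        \<le> ennreal (exp (- s * k)) * (\<Prod>i\<in>I. ?h (g i))"
      by (auto simp: indicator_def simp flip: ennreal_1 intro!: ennreal_leI)
  qed
  also have "\<dots> = ennreal (exp (- s * k)) * (\<Prod>i\<in>I. \<integral>\<^sup>+x. ?h x \<partial>N)"
    using I by (subst nn_integral_cmult) (measurable, subst P.product_nn_integral_prod, simp_all)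
  also have "\<dots> \<le> ennreal (exp (- s * k)) * (\<Prod>i\<in>I. ennreal (exp (?p * (exp s - 1))))"
    by (intro mult_left_mono prod_mono_ennreal factor) simp
  also have "\<dots> = ennreal (exp (real (card I) * (?p * (exp s - 1)) - s * k))"
    using I by (simp add: ennreal_power ennreal_mult'[symmetric] exp_of_nat_mult[symmetric] exp_add[symmetric])
  finally show ?thesis
    by (simp add: P.emeasure_eq_measure)
qed

corollary chernoff_count_lower:
  assumes I: "finite I" and N: "prob_space N" and A: "A \<in> sets N"
    and \<mu>: "\<mu> \<le> real (card I) * measure N A"
  shows "measure (\<Pi>\<^sub>M i\<in>I. N) {g \<in> space (\<Pi>\<^sub>M i\<in>I. N). real (card {i \<in> I. g i \<in> A}) \<le> \<mu> / 4} \<le> exp (- \<mu> / 4)"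
proof -
  have "exp (1 :: real) \<ge> 2" using exp_ge_add_one_self[of "1::real"] by simp
  then have e: "exp (- 1 :: real) \<le> 1 / 2"
    using le_imp_inverse_le[of 2 "exp (1 :: real)"] by (simp add: exp_minus)
  have pos: "real (card I) * measure N A \<ge> 0" by simp
  have "measure (\<Pi>\<^sub>M i\<in>I. N) {g \<in> space (\<Pi>\<^sub>M i\<in>I. N). real (card {i \<in> I. g i \<in> A}) \<le> \<mu> / 4}
      \<le> exp (real (card I) * (measure N A * (exp (- 1) - 1)) + \<mu> / 4)"
    using chernoff_count[OF I N A, of "- 1" "\<mu> / 4"] by simp
  also have "real (card I) * (measure N A * (exp (- 1) - 1)) \<le> real (card I) * measure N A * (- 1 / 2)"
    unfolding mult.assoc[symmetric] by (rule mult_left_mono[OF _ pos]) (use e in simp)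
  also have "\<dots> + \<mu> / 4 \<le> - \<mu> / 4" using \<mu> by simp
  finally show ?thesis by simp
qed

corollary chernoff_count_upper:
  assumes I: "finite I" and N: "prob_space N" and A: "A \<in> sets N"
    and \<mu>: "real (card I) * measure N A \<le> \<mu>"
  shows "measure (\<Pi>\<^sub>M i\<in>I. N) {g \<in> space (\<Pi>\<^sub>M i\<in>I. N). 3 * \<mu> \<le> real (card {i \<in> I. g i \<in> A})} \<le> exp (- \<mu>)"
proof -
  have e: "exp (1 :: real) \<le> 3" by (rule exp_le)
  have pos: "real (card I) * measure N A \<ge> 0" by simp
  have "measure (\<Pi>\<^sub>M i\<in>I. N) {g \<in> space (\<Pi>\<^sub>M i\<in>I. N). 3 * \<mu> \<le> real (card {i \<in> I. g i \<in> A})}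
      \<le> exp (real (card I) * (measure N A * (exp 1 - 1)) - 3 * \<mu>)"
    using chernoff_count[OF I N A, of 1 "3 * \<mu>"] by simp
  also have "real (card I) * (measure N A * (exp 1 - 1)) \<le> real (card I) * measure N A * 2"
    unfolding mult.assoc[symmetric] by (rule mult_left_mono[OF _ pos]) (use e in simp)
  also have "\<dots> - 3 * \<mu> \<le> - \<mu>" using \<mu> by simp
  finally show ?thesis by simp
qed

lemma measure_centred_normal_ge:
  assumes \<sigma>: "\<sigma> > 0" and ab: "a \<le> b" and r: "\<And>z. a \<le> z \<Longrightarrow> z \<le> b \<Longrightarrow> \<bar>z\<bar> \<le> r * \<sigma>"
  shows "measure (centred_normal \<sigma>) {a..b} \<ge> (b - a) / \<sigma> * std_normal_density r"
proof -
  interpret N: prob_space "centred_normal \<sigma>" by (rule prob_space_normal_density[OF \<sigma>])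
  have dens: "normal_density 0 \<sigma> z \<ge> std_normal_density r / \<sigma>" if "a \<le> z" "z \<le> b" for z
  proof -
    have "r * \<sigma> \<ge> 0" using r[OF that] by linarith
    have "z\<^sup>2 \<le> (r * \<sigma>)\<^sup>2" using r[OF that] by (simp add: abs_le_square_iff[symmetric])
    then have "z\<^sup>2 / (2 * \<sigma>\<^sup>2) \<le> r\<^sup>2 / 2" using \<sigma> by (simp add: field_simps power_mult_distrib)
    then show ?thesis
      using \<sigma> by (simp add: normal_density_def real_sqrt_mult field_simps)
  qed
  have "ennreal ((b - a) / \<sigma> * std_normal_density r) = (\<integral>\<^sup>+z. ennreal (std_normal_density r / \<sigma>) * indicator {a..b} z \<partial>lborel)"
    using ab \<sigma> by (subst nn_integral_cmult_indicator) (simp_all add: ennreal_mult'[symmetric] mult.commute)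
  also have "\<dots> \<le> (\<integral>\<^sup>+z. ennreal (normal_density 0 \<sigma> z) * indicator {a..b} z \<partial>lborel)"
    by (intro nn_integral_mono) (auto simp: indicator_def intro!: ennreal_leI dens)
  also have "\<dots> = emeasure (centred_normal \<sigma>) {a..b}"
    by (simp add: emeasure_density)
  finally show ?thesis by (simp add: N.emeasure_eq_measure)
qed

lemma measure_centred_normal_le:
  assumes \<sigma>: "\<sigma> > 0" and ab: "a \<le> b"
  shows "measure (centred_normal \<sigma>) {a..b} \<le> (b - a) / \<sigma>"
proof -
  interpret N: prob_space "centred_normal \<sigma>" by (rule prob_space_normal_density[OF \<sigma>])
  have dens: "normal_density 0 \<sigma> z \<le> 1 / \<sigma>" for z
  proof -
    have "sqrt (2 * pi * \<sigma>\<^sup>2) \<ge> sqrt (1 * \<sigma>\<^sup>2)"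
      using pi_gt3 by (intro real_sqrt_le_mono mult_right_mono) auto
    then have "sqrt (2 * pi * \<sigma>\<^sup>2) \<ge> \<sigma>" using \<sigma> by simp
    then have "1 / sqrt (2 * pi * \<sigma>\<^sup>2) \<le> 1 / \<sigma>" using \<sigma> by (intro divide_left_mono) auto
    moreover have "exp (- (z - 0)\<^sup>2 / (2 * \<sigma>\<^sup>2)) \<le> 1" by simp
    ultimately have "1 / sqrt (2 * pi * \<sigma>\<^sup>2) * exp (- (z - 0)\<^sup>2 / (2 * \<sigma>\<^sup>2)) \<le> 1 / \<sigma> * 1"
      using \<sigma> by (intro mult_mono) auto
    then show ?thesis by (simp add: normal_density_def)
  qed
  have "emeasure (centred_normal \<sigma>) {a..b} = (\<integral>\<^sup>+z. ennreal (normal_density 0 \<sigma> z) * indicator {a..b} z \<partial>lborel)"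
    by (simp add: emeasure_density)
  also have "\<dots> \<le> (\<integral>\<^sup>+z. ennreal (1 / \<sigma>) * indicator {a..b} z \<partial>lborel)"
    by (intro nn_integral_mono) (auto simp: indicator_def intro!: ennreal_leI dens)
  also have "\<dots> = ennreal ((b - a) / \<sigma>)"
    using ab \<sigma> by (simp add: nn_integral_cmult_indicator ennreal_mult'[symmetric])
  finally show ?thesis using ab \<sigma> by (simp add: N.emeasure_eq_measure)
qed

text \<open>
  Beyond \<open>t\<close>, three quarters of the Gaussian exponent are bounded by their value at \<open>t\<close>, and the
  remaining quarter is, up to a factor 2, the density of a normal law of twice the standard
  deviation.
\<close>

lemma measure_centred_normal_tail:
  assumes \<sigma>: "\<sigma> > 0" and t: "t \<ge> 0"
  shows "measure (centred_normal \<sigma>) {z. \<bar>z\<bar> > t} \<le> 2 * exp (- 3 * t\<^sup>2 / (8 * \<sigma>\<^sup>2))"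
proof -
  interpret N: prob_space "centred_normal \<sigma>" by (rule prob_space_normal_density[OF \<sigma>])
  interpret N2: prob_space "centred_normal (2 * \<sigma>)" by (rule prob_space_normal_density) (use \<sigma> in simp)
  let ?c = "2 * exp (- 3 * t\<^sup>2 / (8 * \<sigma>\<^sup>2))"
  have dens: "normal_density 0 \<sigma> z \<le> ?c * normal_density 0 (2 * \<sigma>) z" if "t < \<bar>z\<bar>" for z
  proof -
    have "t\<^sup>2 \<le> z\<^sup>2" using that t by (simp add: abs_le_square_iff[symmetric])
    then have "- z\<^sup>2 / (2 * \<sigma>\<^sup>2) \<le> - 3 * t\<^sup>2 / (8 * \<sigma>\<^sup>2) + - z\<^sup>2 / (2 * (2 * \<sigma>)\<^sup>2)"
      using \<sigma> by (simp add: field_simps power_mult_distrib)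
    then have "exp (- z\<^sup>2 / (2 * \<sigma>\<^sup>2)) \<le> exp (- 3 * t\<^sup>2 / (8 * \<sigma>\<^sup>2)) * exp (- z\<^sup>2 / (2 * (2 * \<sigma>)\<^sup>2))"
      unfolding exp_add[symmetric] by (subst exp_le_cancel_iff)
    then have "1 / sqrt (2 * pi * \<sigma>\<^sup>2) * exp (- z\<^sup>2 / (2 * \<sigma>\<^sup>2)) \<le> 1 / sqrt (2 * pi * \<sigma>\<^sup>2) * (exp (- 3 * t\<^sup>2 / (8 * \<sigma>\<^sup>2)) * exp (- z\<^sup>2 / (2 * (2 * \<sigma>)\<^sup>2)))"
      by (intro mult_left_mono) auto
    moreover have "1 / sqrt (2 * pi * \<sigma>\<^sup>2) = 2 * (1 / sqrt (2 * pi * (2 * \<sigma>)\<^sup>2))"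
    proof -
      have "sqrt (2 * pi * (2 * \<sigma>)\<^sup>2) = sqrt (2 * pi * \<sigma>\<^sup>2 * 2\<^sup>2)"
        by (simp add: power_mult_distrib)
      also have "\<dots> = sqrt (2 * pi * \<sigma>\<^sup>2) * 2"
        by (subst real_sqrt_mult) simp
      finally show ?thesis by simp
    qed
    ultimately show ?thesis by (simp add: normal_density_def)
  qed
  have "emeasure (centred_normal \<sigma>) {z. \<bar>z\<bar> > t} = (\<integral>\<^sup>+z. ennreal (normal_density 0 \<sigma> z) * indicator {z. \<bar>z\<bar> > t} z \<partial>lborel)"
    by (simp add: emeasure_density)
  also have "\<dots> \<le> (\<integral>\<^sup>+z. ennreal (?c * normal_density 0 (2 * \<sigma>) z) \<partial>lborel)"
    by (intro nn_integral_mono) (use dens in \<open>auto simp: indicator_def intro!: ennreal_leI\<close>)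
  also have "\<dots> = ennreal ?c * (\<integral>\<^sup>+z. ennreal (normal_density 0 (2 * \<sigma>) z) \<partial>lborel)"
    by (simp add: ennreal_mult' nn_integral_cmult)
  also have "(\<integral>\<^sup>+z. ennreal (normal_density 0 (2 * \<sigma>) z) \<partial>lborel) = 1"
    using N2.emeasure_space_1 by (simp add: emeasure_density)
  finally show ?thesis by (simp add: N.emeasure_eq_measure)
qed

section \<open>Nets and plane geometry on the sphere\<close>

text \<open>
  Cut the cube into cells of side \<open>1 / K\<close> and choose one point of \<open>Q\<close> from every cell that meets
  \<open>Q\<close>. The net stays inside \<open>Q\<close>, so that its points inherit any relation that defines \<open>Q\<close>, such as
  orthonormality.
\<close>

lemma finite_net:
  fixes h :: "'i \<Rightarrow> 'a \<Rightarrow> real" and K :: nat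
  assumes I: "finite I" and K: "K \<ge> 1" and h: "\<And>i q. i \<in> I \<Longrightarrow> q \<in> Q \<Longrightarrow> \<bar>h i q\<bar> \<le> 1"
  obtains N where "N \<subseteq> Q" "finite N" "card N \<le> (2 * K + 1) ^ card I"
    "\<And>q. q \<in> Q \<Longrightarrow> \<exists>q'\<in>N. \<forall>i\<in>I. \<bar>h i q - h i q'\<bar> \<le> 1 / real K"
proof -
  define cell where "cell q = (\<lambda>i\<in>I. \<lfloor>real K * h i q\<rfloor>)" for q
  define F where "F = I \<rightarrow>\<^sub>E {- int K..int K}"
  define N where "N = inv_into Q cell ` cell ` Q"
  have F: "finite F" "card F = (2 * K + 1) ^ card I"
    using I by (simp_all add: F_def finite_PiE card_PiE)
      (simp add: nat_add_distrib nat_mult_distrib mult.commute)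
  have sub: "cell ` Q \<subseteq> F"
  proof
    fix c assume "c \<in> cell ` Q"
    then obtain q where q: "q \<in> Q" "c = cell q" by blast
    have "\<lfloor>real K * h i q\<rfloor> \<in> {- int K..int K}" if "i \<in> I" for i
    proof -
      have "\<bar>real K * h i q\<bar> \<le> real K"
        using h[OF that q(1)] K by (simp add: abs_mult mult_left_le)
      then have "- real K \<le> real K * h i q" "real K * h i q \<le> real K" by linarith+
      then show ?thesis by (simp add: le_floor_iff) linarith
    qed
    then show "c \<in> F" by (auto simp: q(2) F_def cell_def)
  qed
  show thesis
  proof
    show "N \<subseteq> Q" by (auto simp: N_def inv_into_into)
    show "finite N" using finite_subset[OF sub F(1)] by (simp add: N_def)
    have "card N \<le> card (cell ` Q)"
      unfolding N_def by (rule card_image_le[OF finite_subset[OF sub F(1)]])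
    also have "\<dots> \<le> card F" by (rule card_mono[OF F(1) sub])
    finally show "card N \<le> (2 * K + 1) ^ card I" by (simp add: F)
    fix q assume q: "q \<in> Q"
    define q' where "q' = inv_into Q cell (cell q)"
    have "cell q' = cell q" unfolding q'_def using q by (intro f_inv_into_f) simp
    then have "\<lfloor>real K * h i q\<rfloor> = \<lfloor>real K * h i q'\<rfloor>" if "i \<in> I" for i
      using that by (drule_tac fun_cong[where x = i]) (simp add: cell_def)
    then have "\<bar>real K * h i q - real K * h i q'\<bar> \<le> 1" if "i \<in> I" for i
      using that by (smt (verit) of_int_floor_le real_of_int_floor_add_one_gt)
    then have "\<bar>h i q - h i q'\<bar> \<le> 1 / real K" if "i \<in> I" for i
      using that K unfolding right_diff_distrib[symmetric] abs_mult by (simp add: field_simps)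
    moreover have "q' \<in> N" using q by (simp add: N_def q'_def)
    ultimately show "\<exists>q'\<in>N. \<forall>i\<in>I. \<bar>h i q - h i q'\<bar> \<le> 1 / real K" by blast
  qed
qed

definition orthonormal_pair :: "nat \<Rightarrow> (nat \<Rightarrow> real) \<Rightarrow> (nat \<Rightarrow> real) \<Rightarrow> bool" where
  "orthonormal_pair d x u \<longleftrightarrow> inner_vec d x x = 1 \<and> inner_vec d x u = 0 \<and> inner_vec d u u = 1"

lemma inner_vec_commute: "inner_vec d u v = inner_vec d v u"
  by (simp add: inner_vec_def mult.commute)

lemma inner_vec_combination:
  assumes "\<And>j. j < d \<Longrightarrow> y j = \<alpha> * x j + \<beta> * u j"
  shows "inner_vec d v y = \<alpha> * inner_vec d v x + \<beta> * inner_vec d v u"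
  using assms by (simp add: inner_vec_def sum_distrib_left sum.distrib[symmetric] algebra_simps)

lemma inner_vec_self_nonneg: "inner_vec d v v \<ge> 0"
  unfolding inner_vec_def by (intro sum_nonneg) simp

lemma inner_vec_self_eq_0_iff: "inner_vec d v v = 0 \<longleftrightarrow> (\<forall>j<d. v j = 0)"
  unfolding inner_vec_def by (subst sum_nonneg_eq_0_iff) auto

lemma abs_component_le_1:
  assumes "inner_vec d v v = 1" "j < d"
  shows "\<bar>v j\<bar> \<le> 1"
proof -
  have "v j * v j \<le> inner_vec d v v"
    unfolding inner_vec_def using assms(2) by (intro member_le_sum) auto
  then show ?thesis using assms(1) by (simp add: abs_square_le_1[symmetric] power2_eq_square)
qed

lemma orthonormal_pair_normalise:
  assumes x: "inner_vec d x x = 1" and orth: "inner_vec d x v = 0" and v: "inner_vec d v v \<noteq> 0"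
  shows "orthonormal_pair d x (\<lambda>j. v j / sqrt (inner_vec d v v))"
proof -
  let ?r = "sqrt (inner_vec d v v)"
  have r: "?r * ?r = inner_vec d v v" using inner_vec_self_nonneg[of d v] by simp
  have "inner_vec d w (\<lambda>j. v j / ?r) = inner_vec d w v / ?r" for w
    by (simp add: inner_vec_def sum_divide_distrib)
  then show ?thesis
    unfolding orthonormal_pair_def using x orth v r
    by (simp add: inner_vec_commute[of d "\<lambda>j. v j / ?r" v])
qed

text \<open>
  Turning the first two coordinates of \<open>x\<close> by a right angle gives an orthogonal vector; if both of
  them vanish, the first basis vector does.
\<close>

lemma orthonormal_pair_exists:
  assumes d: "d \<ge> 2" and x: "inner_vec d x x = 1"
  shows "\<exists>u. orthonormal_pair d x u"
proof -
  obtain n where n: "d = Suc (Suc n)" using d by (metis add_2_eq_Suc le_iff_add)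
  define a where "a = (if x 0 = 0 \<and> x 1 = 0 then 1 else x 1)"
  define b where "b = (if x 0 = 0 \<and> x 1 = 0 then 0 else - x 0)"
  define v where "v = (\<lambda>j::nat. if j = 0 then a else if j = 1 then b else 0)"
  have inner: "inner_vec d w v = w 0 * a + w 1 * b" for w
    unfolding n inner_vec_def sum.lessThan_Suc_shift by (simp add: v_def)
  have "inner_vec d x v = 0" by (simp add: inner a_def b_def)
  moreover have "inner_vec d v v \<noteq> 0"
    unfolding inner_vec_self_eq_0_iff using d by (auto simp: v_def a_def b_def intro: exI[of _ 0] exI[of _ 1])
  ultimately show ?thesis using orthonormal_pair_normalise[OF x] by blast
qed

text \<open>
  The vector \<open>u\<close> is the normalised component of \<open>y\<close> orthogonal to \<open>x\<close>. For \<open>y = \<plusminus> x\<close> that component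
  vanishes and any orthogonal unit vector serves.
\<close>

lemma planar_decomposition:
  assumes d: "d \<ge> 2" and x: "inner_vec d x x = 1" and y: "inner_vec d y y = 1"
  obtains u \<alpha> \<beta> where "orthonormal_pair d x u" "\<beta> \<ge> 0" "\<alpha>\<^sup>2 + \<beta>\<^sup>2 = 1"
    "\<And>j. j < d \<Longrightarrow> y j = \<alpha> * x j + \<beta> * u j"
proof -
  define \<alpha> where "\<alpha> = inner_vec d x y"
  define v where "v = (\<lambda>j. y j - \<alpha> * x j)"
  have v: "inner_vec d w v = inner_vec d w y - \<alpha> * inner_vec d w x" for w
    using inner_vec_combination[of d v 1 y "- \<alpha>" x w] by (simp add: v_def)
  have xv: "inner_vec d x v = 0" by (simp add: v x \<alpha>_def)
  have vv: "inner_vec d v v = 1 - \<alpha>\<^sup>2"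
    using xv by (simp add: v inner_vec_commute[of d v] x y \<alpha>_def[symmetric] inner_vec_commute[of d y x] power2_eq_square)
  show thesis
  proof (cases "inner_vec d v v = 0")
    case True
    obtain u where "orthonormal_pair d x u" using orthonormal_pair_exists[OF d x] by blast
    moreover have "y j = \<alpha> * x j + 0 * u j" if "j < d" for j
      using True that unfolding inner_vec_self_eq_0_iff v_def by auto
    moreover have "\<alpha>\<^sup>2 + 0\<^sup>2 = 1" using True vv by simp
    ultimately show thesis using that by blast
  next
    case False
    let ?\<beta> = "sqrt (inner_vec d v v)"
    show thesis
    proof (rule that)
      show "orthonormal_pair d x (\<lambda>j. v j / ?\<beta>)" by (rule orthonormal_pair_normalise[OF x xv False])
      show "?\<beta> \<ge> 0" using inner_vec_self_nonneg by simp
      show "\<alpha>\<^sup>2 + ?\<beta>\<^sup>2 = 1" using vv inner_vec_self_nonneg[of d v] by simp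
      show "y j = \<alpha> * x j + ?\<beta> * (v j / ?\<beta>)" if "j < d" for j
        using False by (simp add: v_def)
    qed
  qed
qed

lemma unit_sphere_inner: "x \<in> unit_sphere d \<Longrightarrow> inner_vec d x x = 1"
  by (simp add: unit_sphere_def L2_set_def inner_vec_def power2_eq_square)

text \<open>
  At a witness \<open>i\<close>, agreement of signs says that
  \<open>\<beta> \<langle>g i, u\<rangle> < \<alpha> \<bar>\<langle>g i, x\<rangle>\<bar> < \<tau>\<close>, which bounds \<open>\<beta>\<close>, the sine of the angle between \<open>x\<close> and \<open>y\<close>.
  The same inequality excludes \<open>\<alpha> \<le> 0\<close>, so the angle is less than a right angle and the distance of
  \<open>x\<close> and \<open>y\<close> is comparable with its sine.
\<close>

proposition sign_agreement_imp_close: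
  assumes d: "d \<ge> 2" and x: "inner_vec d x x = 1" and y: "inner_vec d y y = 1" and h: "h > 0"
    and wit: "\<And>u. orthonormal_pair d x u \<Longrightarrow>
      \<exists>i\<in>S. - \<tau> < inner_vec d (g i) x \<and> inner_vec d (g i) x < 0 \<and> h \<le> inner_vec d (g i) u"
    and agree: "\<And>i. i \<in> S \<Longrightarrow> sgn (inner_vec d (g i) x) = sgn (inner_vec d (g i) y)"
  shows "L2_set (\<lambda>j. x j - y j) {..<d} \<le> 2 * (\<tau> / h)"
proof -
  obtain u \<alpha> \<beta> where u: "orthonormal_pair d x u" and \<beta>: "\<beta> \<ge> 0" and ab: "\<alpha>\<^sup>2 + \<beta>\<^sup>2 = 1"
    and y_eq: "\<And>j. j < d \<Longrightarrow> y j = \<alpha> * x j + \<beta> * u j"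
    by (rule planar_decomposition[OF d x y]) (rule that; assumption)
  obtain i where i: "i \<in> S" and X: "- \<tau> < inner_vec d (g i) x" "inner_vec d (g i) x < 0"
    and U: "h \<le> inner_vec d (g i) u"
    using wit[OF u] by blast
  have "inner_vec d (g i) y < 0"
    using agree[OF i] X(2) by (metis sgn_less)
  then have neg: "\<alpha> * inner_vec d (g i) x + \<beta> * inner_vec d (g i) u < 0"
    by (simp add: inner_vec_combination[OF y_eq])
  have bU: "\<beta> * h \<le> \<beta> * inner_vec d (g i) u" using U \<beta> by (rule mult_left_mono)
  have bh: "\<beta> * h \<ge> 0" using \<beta> h by simp
  have "\<alpha> > 0"
  proof (rule ccontr)
    assume "\<not> \<alpha> > 0"
    then have "\<alpha> * inner_vec d (g i) x \<ge> 0" using X(2) by (simp add: mult_nonpos_nonpos)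
    then show False using neg bU bh by linarith
  qed
  have "\<alpha>\<^sup>2 \<le> 1" using ab by (smt (verit) zero_le_power2)
  then have a1: "\<alpha> \<le> 1" by (simp add: abs_square_le_1)
  have "- \<alpha> * inner_vec d (g i) x \<le> - 1 * inner_vec d (g i) x"
    using a1 X(2) by (intro mult_right_mono_neg) auto
  then have "\<beta> * h \<le> \<tau>" using neg bU X(1) by linarith
  then have b: "\<beta> \<le> \<tau> / h" using h by (simp add: field_simps)
  have diff: "\<And>j. j < d \<Longrightarrow> x j - y j = (1 - \<alpha>) * x j + (- \<beta>) * u j"
    by (simp add: y_eq algebra_simps)
  have "inner_vec d (\<lambda>j. x j - y j) (\<lambda>j. x j - y j) = (1 - \<alpha>)\<^sup>2 + \<beta>\<^sup>2"
  proof -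
    let ?w = "\<lambda>j. x j - y j"
    have "inner_vec d x ?w = 1 - \<alpha>" "inner_vec d u ?w = - \<beta>"
      using u inner_vec_combination[of d ?w "1 - \<alpha>" x "- \<beta>" u, OF diff]
      by (simp_all add: orthonormal_pair_def inner_vec_commute[of d u x])
    then show ?thesis
      using inner_vec_combination[of d ?w "1 - \<alpha>" x "- \<beta>" u ?w, OF diff]
      by (simp add: inner_vec_commute[of d ?w x] inner_vec_commute[of d ?w u] power2_eq_square)
  qed
  also have "\<dots> \<le> (2 * \<beta>)\<^sup>2"
  proof -
    have "(1 - \<alpha>)\<^sup>2 \<le> (1 - \<alpha>) * (1 + \<alpha>)"
      unfolding power2_eq_square using a1 \<open>\<alpha> > 0\<close> by (intro mult_left_mono) auto
    also have "\<dots> = \<beta>\<^sup>2" using ab by (simp add: algebra_simps power2_eq_square)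
    finally show ?thesis by (simp add: power_mult_distrib) (smt (verit) zero_le_power2)
  qed
  finally have "L2_set (\<lambda>j. x j - y j) {..<d} \<le> sqrt ((2 * \<beta>)\<^sup>2)"
    unfolding L2_set_def inner_vec_def by (intro real_sqrt_le_mono) (simp add: power2_eq_square)
  also have "\<dots> = 2 * \<beta>" using \<beta> by (intro real_sqrt_unique) simp_all
  finally show ?thesis using b by linarith
qed

lemma inner_vec_perturb:
  assumes "\<And>j. j < d \<Longrightarrow> \<bar>v j\<bar> \<le> B" "\<And>j. j < d \<Longrightarrow> \<bar>x j - x' j\<bar> \<le> \<epsilon>"
  shows "\<bar>inner_vec d v x - inner_vec d v x'\<bar> \<le> real d * (B * \<epsilon>)"
proof -
  have "\<bar>inner_vec d v x - inner_vec d v x'\<bar> = \<bar>\<Sum>j<d. v j * (x j - x' j)\<bar>"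
    by (simp add: inner_vec_def sum_subtractf[symmetric] right_diff_distrib)
  also have "\<dots> \<le> (\<Sum>j<d. \<bar>v j * (x j - x' j)\<bar>)" by (rule sum_abs)
  also have "\<dots> \<le> (\<Sum>j<d. B * \<epsilon>)"
  proof (rule sum_mono)
    fix j assume "j \<in> {..<d}"
    then have a: "\<bar>v j\<bar> \<le> B" "\<bar>x j - x' j\<bar> \<le> \<epsilon>" using assms by auto
    have "B \<ge> 0" using a(1) by linarith
    then show "\<bar>v j * (x j - x' j)\<bar> \<le> B * \<epsilon>" unfolding abs_mult using a by (intro mult_mono) auto
  qed
  finally show ?thesis by simp
qed

section \<open>The counts for the pairs of a finite net\<close>

lemma gaussian_vec_eq: "gaussian_vec d = (\<Pi>\<^sub>M j\<in>{..<d}. centred_normal (1 / sqrt (real d)))"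
  by (simp add: gaussian_vec_def)

lemma prob_space_gaussian_vec:
  assumes "d \<ge> 1"
  shows "prob_space (gaussian_vec d)"
  unfolding gaussian_vec_eq using assms
  by (intro prob_space_PiM prob_space_centred_normal) simp

lemma coordinate_measurable: "j < d \<Longrightarrow> (\<lambda>v. v j) \<in> borel_measurable (gaussian_vec d)"
  unfolding gaussian_vec_eq by (rule measurable_compose[OF measurable_component_singleton]) auto

lemma inner_vec_measurable[measurable]: "(\<lambda>v. inner_vec d v x) \<in> borel_measurable (gaussian_vec d)"
  unfolding inner_vec_def gaussian_vec_eq by measurable

lemma gaussian_vec_orthonormal_pair:
  assumes d: "d \<ge> 1" and on: "orthonormal_pair d x u" and AB: "A \<in> sets borel" "B \<in> sets borel"
  shows "measure (gaussian_vec d) {v \<in> space (gaussian_vec d). inner_vec d v x \<in> A \<and> inner_vec d v u \<in> B}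
    = measure (centred_normal (1 / sqrt (real d))) A * measure (centred_normal (1 / sqrt (real d))) B"
proof -
  have "(\<Sum>j<d. (x j)\<^sup>2) = 1" "(\<Sum>j<d. x j * u j) = 0" "(\<Sum>j<d. (u j)\<^sup>2) = 1"
    using on by (simp_all add: orthonormal_pair_def inner_vec_def power2_eq_square)
  from measure_orthonormal_pair_normal[OF _ this AB, of "1 / sqrt (real d)"] d
  show ?thesis by (simp add: gaussian_vec_eq inner_vec_def)
qed

text \<open>
  The constraints are stricter than those on a witness: \<open>\<langle>v, x\<rangle>\<close> keeps distance \<open>\<tau> / 4\<close> from the ends
  of \<open>(- \<tau>, 0)\<close> and \<open>\<langle>v, u\<rangle>\<close> is at least twice as large as required, so that they survive a small
  perturbation of \<open>(x, u)\<close>. The upper end \<open>2 / \<surd>d\<close> makes the probability bound an estimate of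
  densities on bounded intervals. Likewise \<open>slab_set\<close> is wider than the slab \<open>(- \<tau>, 0)\<close>.
\<close>

definition hit_set :: "nat \<Rightarrow> real \<Rightarrow> (nat \<Rightarrow> real) \<Rightarrow> (nat \<Rightarrow> real) \<Rightarrow> (nat \<Rightarrow> real) set" where
  "hit_set d \<tau> x u = {v \<in> space (gaussian_vec d). inner_vec d v x \<in> {- (3 * \<tau> / 4)..- (\<tau> / 4)}
     \<and> inner_vec d v u \<in> {1 / sqrt (real d)..2 / sqrt (real d)}}"

definition slab_set :: "nat \<Rightarrow> real \<Rightarrow> (nat \<Rightarrow> real) \<Rightarrow> (nat \<Rightarrow> real) set" where
  "slab_set d \<tau> x = {v \<in> space (gaussian_vec d). inner_vec d v x \<in> {- 2 * \<tau>..\<tau>}}"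

lemma hit_set_measurable[measurable]: "hit_set d \<tau> x u \<in> sets (gaussian_vec d)"
  unfolding hit_set_def by measurable

lemma slab_set_measurable[measurable]: "slab_set d \<tau> x \<in> sets (gaussian_vec d)"
  unfolding slab_set_def by measurable

text \<open>
  A lower bound for the probability of a hit per unit of \<open>\<surd>d \<tau>\<close>: both variables stay within the
  given multiples 1 and 2 of the standard deviation, and the slab has width \<open>\<tau> / 2\<close>.
\<close>

definition hit_const :: real where
  "hit_const = std_normal_density 1 * std_normal_density 2 / 2"

lemma hit_const_bounds: "0 < hit_const" "hit_const \<le> 1"
proof -
  show "0 < hit_const" by (simp add: hit_const_def normal_density_pos)
  have "std_normal_density r \<le> 1" for r
  proof -
    have "sqrt (2 * pi) \<ge> 1" using pi_gt3 by (subst real_sqrt_ge_1_iff) simp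
    moreover have "exp (- r\<^sup>2 / 2) \<le> 1" by simp
    ultimately have "1 / sqrt (2 * pi) * exp (- r\<^sup>2 / 2) \<le> 1 * 1"
      by (intro mult_mono) auto
    then show ?thesis by (simp add: std_normal_density_def)
  qed
  then have "std_normal_density 1 * std_normal_density 2 \<le> 1 * 1"
    by (intro mult_mono) auto
  then show "hit_const \<le> 1" by (simp add: hit_const_def)
qed

lemma measure_hit_set_ge:
  assumes d: "d \<ge> 1" and on: "orthonormal_pair d x u" and \<tau>: "0 < \<tau>" "sqrt (real d) * \<tau> \<le> 1"
  shows "hit_const * (sqrt (real d) * \<tau>) \<le> measure (gaussian_vec d) (hit_set d \<tau> x u)"
proof -
  define \<sigma> where "\<sigma> = 1 / sqrt (real d)"
  have \<sigma>: "\<sigma> > 0" using d by (simp add: \<sigma>_def)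
  have \<tau>\<sigma>: "\<tau> \<le> \<sigma>" "sqrt (real d) * \<tau> = \<tau> / \<sigma>" using \<tau> d by (simp_all add: \<sigma>_def field_simps)
  let ?A = "{- (3 * \<tau> / 4)..- (\<tau> / 4)}" and ?B = "{\<sigma>..2 * \<sigma>}"
  have "(- (\<tau> / 4) - - (3 * \<tau> / 4)) / \<sigma> * std_normal_density 1 \<le> measure (centred_normal \<sigma>) ?A"
    using \<tau> \<tau>\<sigma> by (intro measure_centred_normal_ge[OF \<sigma>]) auto
  then have A: "\<tau> / \<sigma> * std_normal_density 1 / 2 \<le> measure (centred_normal \<sigma>) ?A"
    by (simp add: field_simps)
  have "(2 * \<sigma> - \<sigma>) / \<sigma> * std_normal_density 2 \<le> measure (centred_normal \<sigma>) ?B"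
    using \<sigma> by (intro measure_centred_normal_ge[OF \<sigma>]) auto
  then have B: "std_normal_density 2 \<le> measure (centred_normal \<sigma>) ?B"
    using \<sigma> by simp
  have "hit_const * (\<tau> / \<sigma>) = \<tau> / \<sigma> * std_normal_density 1 / 2 * std_normal_density 2"
    by (simp add: hit_const_def ac_simps)
  also have "\<dots> \<le> measure (centred_normal \<sigma>) ?A * measure (centred_normal \<sigma>) ?B"
    by (intro mult_mono A B) auto
  also have "\<dots> = measure (gaussian_vec d) (hit_set d \<tau> x u)"
    unfolding hit_set_def using gaussian_vec_orthonormal_pair[OF d on, of ?A ?B] by (simp add: \<sigma>_def)
  finally show ?thesis by (simp add: \<tau>\<sigma>)
qed

lemma measure_slab_set_le:
  assumes d: "d \<ge> 1" and on: "orthonormal_pair d x u" and \<tau>: "0 < \<tau>"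
  shows "measure (gaussian_vec d) (slab_set d \<tau> x) \<le> 3 * (sqrt (real d) * \<tau>)"
proof -
  define \<sigma> where "\<sigma> = 1 / sqrt (real d)"
  have \<sigma>: "\<sigma> > 0" using d by (simp add: \<sigma>_def)
  interpret N: prob_space "centred_normal \<sigma>" by (rule prob_space_centred_normal[OF \<sigma>])
  have "measure (centred_normal \<sigma>) UNIV = 1" using N.prob_space by simp
  then have "measure (gaussian_vec d) (slab_set d \<tau> x) = measure (centred_normal \<sigma>) {- 2 * \<tau>..\<tau>}"
    unfolding slab_set_def using gaussian_vec_orthonormal_pair[OF d on, of "{- 2 * \<tau>..\<tau>}" UNIV]
    by (simp add: \<sigma>_def)
  also have "\<dots> \<le> (\<tau> - - 2 * \<tau>) / \<sigma>"
    using \<tau> by (intro measure_centred_normal_le[OF \<sigma>]) simp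
  also have "\<dots> = 3 * (sqrt (real d) * \<tau>)" by (simp add: \<sigma>_def)
  finally show ?thesis .
qed

lemma measure_component_tail:
  assumes d: "d \<ge> 1" and i: "i \<in> I" "finite I" and j: "j < d" and t: "t \<ge> 0"
  shows "measure (\<Pi>\<^sub>M i\<in>I. gaussian_vec d) {g \<in> space (\<Pi>\<^sub>M i\<in>I. gaussian_vec d). t < \<bar>g i j\<bar>}
    \<le> 2 * exp (- 3 * real d * t\<^sup>2 / 8)"
proof -
  define \<sigma> where "\<sigma> = 1 / sqrt (real d)"
  have \<sigma>: "\<sigma> > 0" using d by (simp add: \<sigma>_def)
  have \<sigma>2: "\<sigma>\<^sup>2 = 1 / real d" by (simp add: \<sigma>_def power_divide)
  let ?G = "gaussian_vec d" and ?N = "centred_normal \<sigma>"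
  have G: "?G = (\<Pi>\<^sub>M j\<in>{..<d}. ?N)" by (simp add: gaussian_vec_eq \<sigma>_def)
  have dG: "distr (\<Pi>\<^sub>M i\<in>I. ?G) ?G (\<lambda>g. g i) = ?G"
    using distr_PiM_component[of I "\<lambda>_. ?G" i] prob_space_gaussian_vec[OF d] i by simp
  have dN: "distr ?G ?N (\<lambda>v. v j) = ?N"
    unfolding G using distr_PiM_component[of "{..<d}" "\<lambda>_. ?N" j] prob_space_centred_normal[OF \<sigma>] j by simp
  note [measurable] = coordinate_measurable[OF j]
  have "measure ?N {z. t < \<bar>z\<bar>} = measure (distr ?G ?N (\<lambda>v. v j)) {z. t < \<bar>z\<bar>}" by (simp add: dN)
  also have "\<dots> = measure ?G {v \<in> space ?G. t < \<bar>v j\<bar>}"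
    by (subst measure_distr) (auto intro!: arg_cong2[where f = measure])
  also have "\<dots> = measure (distr (\<Pi>\<^sub>M i\<in>I. ?G) ?G (\<lambda>g. g i)) {v \<in> space ?G. t < \<bar>v j\<bar>}" by (simp add: dG)
  also have "\<dots> = measure (\<Pi>\<^sub>M i\<in>I. ?G) {g \<in> space (\<Pi>\<^sub>M i\<in>I. ?G). t < \<bar>g i j\<bar>}"
  proof (subst measure_distr)
    show "(\<lambda>g. g i) \<in> measurable (\<Pi>\<^sub>M i\<in>I. ?G) ?G" using i by simp
    show "{v \<in> space ?G. t < \<bar>v j\<bar>} \<in> sets ?G" by measurable
    show "measure (\<Pi>\<^sub>M i\<in>I. ?G) ((\<lambda>g. g i) -` {v \<in> space ?G. t < \<bar>v j\<bar>} \<inter> space (\<Pi>\<^sub>M i\<in>I. ?G))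
      = measure (\<Pi>\<^sub>M i\<in>I. ?G) {g \<in> space (\<Pi>\<^sub>M i\<in>I. ?G). t < \<bar>g i j\<bar>}"
      using i by (intro arg_cong2[where f = measure]) (auto simp: space_PiM)
  qed
  finally show ?thesis
    using measure_centred_normal_tail[OF \<sigma> t] by (simp add: \<sigma>2 mult.commute mult.left_commute)
qed

text \<open>
  A union bound. The number \<open>\<mu>\<close> is the scale of the counts: the expected number of hits is at least
  \<open>hit_const * \<mu>\<close>, and the expected number of indices in a wide slab is at most \<open>3 * \<mu>\<close>.
\<close>

lemma net_event:
  fixes M :: nat
  assumes d: "d \<ge> 1" and \<tau>: "0 < \<tau>" "sqrt (real d) * \<tau> \<le> 1"
    and N: "finite N" "\<And>x u. (x, u) \<in> N \<Longrightarrow> orthonormal_pair d x u"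
  defines "G \<equiv> \<Pi>\<^sub>M i\<in>{1..M}. gaussian_vec d"
    and "\<mu> \<equiv> sqrt (real d) * \<tau> * real M"
  obtains E where "E \<in> sets G"
    "measure G E \<ge> 1 - 2 * real M * real d * exp (- 3 * real d * (real M)\<^sup>2 / 8)
       - real (card N) * (exp (- hit_const * \<mu> / 4) + exp (- 3 * \<mu>))"
    "\<And>g i j. g \<in> E \<Longrightarrow> i \<in> {1..M} \<Longrightarrow> j < d \<Longrightarrow> \<bar>g i j\<bar> \<le> real M"
    "\<And>g x u. g \<in> E \<Longrightarrow> (x, u) \<in> N \<Longrightarrow> hit_const * \<mu> / 4 < real (card {i \<in> {1..M}. g i \<in> hit_set d \<tau> x u})"
    "\<And>g x u. g \<in> E \<Longrightarrow> (x, u) \<in> N \<Longrightarrow> real (card {i \<in> {1..M}. g i \<in> slab_set d \<tau> x}) < 9 * \<mu>"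
proof -
  note pG = prob_space_gaussian_vec[OF d]
  interpret G: prob_space G unfolding G_def by (intro prob_space_PiM pG)
  \<comment> \<open>The three kinds of bad events: a large coordinate, too few hits, too many indices in a slab.\<close>
  define T where "T = (\<lambda>(i, j). {g \<in> space G. real M < \<bar>g i j\<bar>})"
  define H where "H = (\<lambda>(x, u). {g \<in> space G. real (card {i \<in> {1..M}. g i \<in> hit_set d \<tau> x u}) \<le> hit_const * \<mu> / 4})"
  define L where "L = (\<lambda>(x, u :: nat \<Rightarrow> real). {g \<in> space G. 3 * (3 * \<mu>) \<le> real (card {i \<in> {1..M}. g i \<in> slab_set d \<tau> x})})"
  define J where "J = {1..M} \<times> {..<d}"
  have count: "(\<lambda>g. real (card {i \<in> {1..M}. g i \<in> A})) \<in> borel_measurable G"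
    if [measurable]: "A \<in> sets (gaussian_vec d)" for A
  proof -
    have "real (card {i \<in> {1..M}. g i \<in> A}) = (\<Sum>i\<in>{1..M}. indicator A (g i))" for g
      by (simp add: indicator_def sum.If_cases Int_def)
    then show ?thesis unfolding G_def by simp
  qed
  have T: "T q \<in> sets G" "measure G (T q) \<le> 2 * exp (- 3 * real d * (real M)\<^sup>2 / 8)" if "q \<in> J" for q
  proof -
    obtain i j where q: "q = (i, j)" "i \<in> {1..M}" "j < d" using \<open>q \<in> J\<close> by (auto simp: J_def)
    have "(\<lambda>g. g i j) \<in> borel_measurable G"
      unfolding G_def using q
      by (intro measurable_compose[OF _ coordinate_measurable[of j d], of "\<lambda>g. g i"]) auto
    then show "T q \<in> sets G" unfolding T_def q by simp
    show "measure G (T q) \<le> 2 * exp (- 3 * real d * (real M)\<^sup>2 / 8)"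
      unfolding T_def q G_def prod.case using q by (intro measure_component_tail[OF d]) auto
  qed
  have H: "H q \<in> sets G" "measure G (H q) \<le> exp (- hit_const * \<mu> / 4)" if "q \<in> N" for q
  proof -
    obtain x u where q: "q = (x, u)" "orthonormal_pair d x u" using N(2) \<open>q \<in> N\<close> by (cases q) auto
    note count[OF hit_set_measurable, of \<tau> x u, measurable]
    show "H q \<in> sets G" unfolding H_def q(1) prod.case by measurable
    have "hit_const * \<mu> \<le> real (card {1..M}) * measure (gaussian_vec d) (hit_set d \<tau> x u)"
      using mult_left_mono[OF measure_hit_set_ge[OF d q(2) \<tau>], of "real M"]
      by (simp add: \<mu>_def ac_simps)
    from chernoff_count_lower[OF _ pG hit_set_measurable this]
    show "measure G (H q) \<le> exp (- hit_const * \<mu> / 4)" unfolding H_def q G_def by simp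
  qed
  have L: "L q \<in> sets G" "measure G (L q) \<le> exp (- 3 * \<mu>)" if "q \<in> N" for q
  proof -
    obtain x u where q: "q = (x, u)" "orthonormal_pair d x u" using N(2) \<open>q \<in> N\<close> by (cases q) auto
    note count[OF slab_set_measurable, of \<tau> x, measurable]
    show "L q \<in> sets G" unfolding L_def q(1) prod.case by measurable
    have "real (card {1..M}) * measure (gaussian_vec d) (slab_set d \<tau> x) \<le> 3 * \<mu>"
      using mult_left_mono[OF measure_slab_set_le[OF d q(2) \<tau>(1)], of "real M"]
      by (simp add: \<mu>_def ac_simps)
    from chernoff_count_upper[OF _ pG slab_set_measurable this]
    show "measure G (L q) \<le> exp (- 3 * \<mu>)" unfolding L_def q G_def by simp
  qed
  have fJ: "finite J" "card J = M * d" by (simp_all add: J_def)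
  define bad where "bad = (\<Union>q\<in>J. T q) \<union> (\<Union>q\<in>N. H q \<union> L q)"
  have bad[measurable]: "bad \<in> sets G"
    unfolding bad_def using T(1) H(1) L(1) fJ N(1) by (intro sets.Un sets.finite_UN) auto
  have "measure G bad \<le> measure G (\<Union>q\<in>J. T q) + measure G (\<Union>q\<in>N. H q \<union> L q)"
    unfolding bad_def using T(1) H(1) L(1) fJ N(1)
    by (intro measure_Un_le sets.Un sets.finite_UN) auto
  also have "measure G (\<Union>q\<in>J. T q) \<le> (\<Sum>q\<in>J. measure G (T q))"
    using T(1) fJ by (intro G.finite_measure_subadditive_finite) auto
  also have "\<dots> \<le> (\<Sum>q\<in>J. 2 * exp (- 3 * real d * (real M)\<^sup>2 / 8))" by (intro sum_mono T(2))
  also have "\<dots> = 2 * real M * real d * exp (- 3 * real d * (real M)\<^sup>2 / 8)" by (simp add: fJ)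
  also have "measure G (\<Union>q\<in>N. H q \<union> L q) \<le> (\<Sum>q\<in>N. measure G (H q \<union> L q))"
    using H(1) L(1) N by (intro G.finite_measure_subadditive_finite) auto
  also have "\<dots> \<le> (\<Sum>q\<in>N. exp (- hit_const * \<mu> / 4) + exp (- 3 * \<mu>))"
  proof (rule sum_mono)
    fix q assume q: "q \<in> N"
    show "measure G (H q \<union> L q) \<le> exp (- hit_const * \<mu> / 4) + exp (- 3 * \<mu>)"
      using measure_Un_le[OF H(1) L(1), OF q q] H(2)[OF q] L(2)[OF q] by linarith
  qed
  also have "\<dots> = real (card N) * (exp (- hit_const * \<mu> / 4) + exp (- 3 * \<mu>))" by simp
  finally have m: "measure G bad \<le> 2 * real M * real d * exp (- 3 * real d * (real M)\<^sup>2 / 8)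
    + real (card N) * (exp (- hit_const * \<mu> / 4) + exp (- 3 * \<mu>))" by simp
  show thesis
  proof (rule that[of "space G - bad"])
    show "space G - bad \<in> sets G" by simp
    show "measure G (space G - bad) \<ge> 1 - 2 * real M * real d * exp (- 3 * real d * (real M)\<^sup>2 / 8)
       - real (card N) * (exp (- hit_const * \<mu> / 4) + exp (- 3 * \<mu>))"
      using m G.prob_compl[OF bad] by simp
    fix g assume g: "g \<in> space G - bad"
    show "\<bar>g i j\<bar> \<le> real M" if "i \<in> {1..M}" "j < d" for i j
    proof -
      have "(i, j) \<in> J" using that by (simp add: J_def)
      then have "g \<notin> T (i, j)" using g by (auto simp: bad_def)
      then show ?thesis using g by (simp add: T_def)
    qed
    show "hit_const * \<mu> / 4 < real (card {i \<in> {1..M}. g i \<in> hit_set d \<tau> x u})" if "(x, u) \<in> N" for x u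
    proof -
      have "g \<notin> H (x, u)" using g that by (auto simp: bad_def)
      then show ?thesis using g by (simp add: H_def)
    qed
    show "real (card {i \<in> {1..M}. g i \<in> slab_set d \<tau> x}) < 9 * \<mu>" if "(x, u) \<in> N" for x u
    proof -
      have "g \<notin> L (x, u)" using g that by (auto simp: bad_def)
      then show ?thesis using g by (simp add: L_def)
    qed
  qed
qed

section \<open>Uniform counts over all orthonormal pairs\<close>

text \<open>
The number of cells of the grid with resolution \<open>1 / (8 M\<^sup>3)\<close> in \<open>2 d\<close> coordinates.
\<close>

lemma net_cardinality_bound:
  assumes M: "(M::nat) \<ge> 3"
  shows "real ((2 * (8 * M ^ 3) + 1) ^ (2 * d)) \<le> exp (14 * real d * ln (real M))"
proof -
  have "3 ^ 4 \<le> M ^ 4" using M by (rule power_mono) simp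
  then have "17 * M ^ 3 \<le> M ^ 4 * M ^ 3" by (intro mult_right_mono) simp_all
  moreover have "1 \<le> M ^ 3" using M by simp
  moreover have "M ^ 4 * M ^ 3 = M ^ 7" by (simp add: power_add[symmetric])
  ultimately have "2 * (8 * M ^ 3) + 1 \<le> M ^ 7" by linarith
  then have "(2 * (8 * M ^ 3) + 1) ^ (2 * d) \<le> (M ^ 7) ^ (2 * d)" by (rule power_mono) simp
  then have "real ((2 * (8 * M ^ 3) + 1) ^ (2 * d)) \<le> real ((M ^ 7) ^ (2 * d))"
    by (subst of_nat_le_iff)
  also have "\<dots> = real M ^ (14 * d)" by (simp add: power_mult[symmetric])
  also have "\<dots> = exp (real (14 * d) * ln (real M))"
    using M by (subst exp_of_nat_mult) simp
  finally show ?thesis by simp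
qed

text \<open>
  Passing from the net to all pairs. On the event of bounded coordinates an inner product changes
  by at most \<open>\<eta> = d M / (8 M\<^sup>3) \<le> 1 / (8 M)\<close> when a vector is replaced by its net point. As
  \<open>\<tau> \<ge> 1 / M\<close>, this is at most \<open>\<tau> / 8\<close>, and as \<open>\<surd>d \<le> M\<close> it is at most \<open>1 / (2 \<surd>d)\<close>; \<open>hit_set\<close> and
  \<open>slab_set\<close> leave room for such an error.
\<close>

proposition uniform_slab_counts:
  fixes M :: nat
  assumes d: "d \<ge> 2" and M: "M \<ge> 3" "d \<le> M"
    and \<tau>: "1 / real M \<le> \<tau>" "sqrt (real d) * \<tau> \<le> 1"
  defines "G \<equiv> \<Pi>\<^sub>M i\<in>{1..M}. gaussian_vec d"
    and "\<mu> \<equiv> sqrt (real d) * \<tau> * real M"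
  obtains E where "E \<in> sets G"
    "measure G E \<ge> 1 - 2 * real M * real d * exp (- 3 * real d * (real M)\<^sup>2 / 8)
       - exp (14 * real d * ln (real M)) * (exp (- hit_const * \<mu> / 4) + exp (- 3 * \<mu>))"
    "\<And>g x u. g \<in> E \<Longrightarrow> orthonormal_pair d x u \<Longrightarrow>
      hit_const * \<mu> / 4 < real (card {i \<in> W_set d M g \<tau> x. 1 / (2 * sqrt (real d)) \<le> inner_vec d (g i) u})"
    "\<And>g x. g \<in> E \<Longrightarrow> inner_vec d x x = 1 \<Longrightarrow> real (card (W_set d M g \<tau> x)) < 9 * \<mu>"
proof -
  \<comment> \<open>A pair of vectors is one point with the \<open>2 d\<close> coordinates \<open>(j, True)\<close> and \<open>(j, False)\<close>.\<close>
  define I where "I = {..<d} \<times> (UNIV :: bool set)"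
  define Q where "Q = {(x, u). orthonormal_pair d x u}"
  define h where "h = (\<lambda>(j :: nat, b) q. if b then fst q j else snd q j :: real)"
  have I: "finite I" "card I = 2 * d" by (simp_all add: I_def card_cartesian_product)
  have K: "8 * M ^ 3 \<ge> (1::nat)" using M by simp
  have "\<bar>h i q\<bar> \<le> 1" if "i \<in> I" "q \<in> Q" for i q
    using that abs_component_le_1[of d "fst q"] abs_component_le_1[of d "snd q"]
    by (auto simp: I_def Q_def h_def orthonormal_pair_def)
  from finite_net[OF I(1) K, of Q h, OF this]
  obtain N where N: "N \<subseteq> Q" "finite N" "card N \<le> (2 * (8 * M ^ 3) + 1) ^ card I"
    and net: "\<And>q. q \<in> Q \<Longrightarrow> \<exists>q'\<in>N. \<forall>i\<in>I. \<bar>h i q - h i q'\<bar> \<le> 1 / real (8 * M ^ 3)" by blast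
  have cardN: "real (card N) \<le> exp (14 * real d * ln (real M))"
  proof -
    have "real (card N) \<le> real ((2 * (8 * M ^ 3) + 1) ^ (2 * d))"
      using N(3) unfolding I(2) by (subst of_nat_le_iff)
    then show ?thesis using net_cardinality_bound[OF M(1), of d] by linarith
  qed
  have M0: "real M > 0" using M by simp
  have d1: "d \<ge> 1" using d by simp
  have \<tau>0: "\<tau> > 0" using \<tau>(1) M0 by (smt (verit) divide_pos_pos)
  have NQ: "orthonormal_pair d x u" if "(x, u) \<in> N" for x u using that N(1) by (auto simp: Q_def)
  obtain E where E: "E \<in> sets G"
    "measure G E \<ge> 1 - 2 * real M * real d * exp (- 3 * real d * (real M)\<^sup>2 / 8)
       - real (card N) * (exp (- hit_const * \<mu> / 4) + exp (- 3 * \<mu>))"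
    and bnd: "\<And>g i j. g \<in> E \<Longrightarrow> i \<in> {1..M} \<Longrightarrow> j < d \<Longrightarrow> \<bar>g i j\<bar> \<le> real M"
    and hit: "\<And>g x u. g \<in> E \<Longrightarrow> (x, u) \<in> N \<Longrightarrow> hit_const * \<mu> / 4 < real (card {i \<in> {1..M}. g i \<in> hit_set d \<tau> x u})"
    and slab: "\<And>g x u. g \<in> E \<Longrightarrow> (x, u) \<in> N \<Longrightarrow> real (card {i \<in> {1..M}. g i \<in> slab_set d \<tau> x}) < 9 * \<mu>"
    by (rule net_event[OF d1 \<tau>0 \<tau>(2) N(2) NQ, of M, folded G_def \<mu>_def]) (auto intro: that)
  define \<eta> where "\<eta> = real d * (real M * (1 / real (8 * M ^ 3)))"
  have \<eta>M: "\<eta> \<le> 1 / (8 * real M)"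
  proof -
    have "\<eta> = real d / real M * (1 / (8 * real M))"
      using M0 by (simp add: \<eta>_def power3_eq_cube)
    also have "\<dots> \<le> 1 * (1 / (8 * real M))"
      using M by (intro mult_right_mono) auto
    finally show ?thesis by simp
  qed
  have \<eta>\<tau>: "\<eta> \<le> \<tau> / 8" using \<eta>M \<tau>(1) by simp
  have \<eta>d: "\<eta> \<le> 1 / (2 * sqrt (real d))"
  proof -
    have "sqrt (real d) \<le> sqrt (real d * real d)" using d by (intro real_sqrt_le_mono) simp
    then have "2 * sqrt (real d) \<le> 8 * real M" using M by simp
    then have "1 / (8 * real M) \<le> 1 / (2 * sqrt (real d))" using d M0 by (intro divide_left_mono) auto
    then show ?thesis using \<eta>M by linarith
  qed
  have approx: "\<exists>x' u'. (x', u') \<in> N \<and> (\<forall>g\<in>E. \<forall>i\<in>{1..M}.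
      \<bar>inner_vec d (g i) x - inner_vec d (g i) x'\<bar> \<le> \<eta> \<and> \<bar>inner_vec d (g i) u - inner_vec d (g i) u'\<bar> \<le> \<eta>)"
    if "orthonormal_pair d x u" for x u
  proof -
    have "(x, u) \<in> Q" using that by (simp add: Q_def)
    from net[OF this] obtain x' u' where q: "(x', u') \<in> N"
      and cl: "\<forall>i\<in>I. \<bar>h i (x, u) - h i (x', u')\<bar> \<le> 1 / real (8 * M ^ 3)" by auto
    have "\<bar>x j - x' j\<bar> \<le> 1 / real (8 * M ^ 3)" "\<bar>u j - u' j\<bar> \<le> 1 / real (8 * M ^ 3)" if "j < d" for j
      using bspec[OF cl, of "(j, True)"] bspec[OF cl, of "(j, False)"] that by (simp_all add: I_def h_def)
    then show ?thesis
      unfolding \<eta>_def using q bnd by (intro exI[of _ x'] exI[of _ u'] conjI ballI inner_vec_perturb) auto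
  qed
  have lower: "hit_const * \<mu> / 4 < real (card {i \<in> W_set d M g \<tau> x. 1 / (2 * sqrt (real d)) \<le> inner_vec d (g i) u})"
    if g: "g \<in> E" and on: "orthonormal_pair d x u" for g x u
  proof -
    obtain x' u' where q: "(x', u') \<in> N" and ap: "\<And>i. i \<in> {1..M} \<Longrightarrow>
      \<bar>inner_vec d (g i) x - inner_vec d (g i) x'\<bar> \<le> \<eta> \<and> \<bar>inner_vec d (g i) u - inner_vec d (g i) u'\<bar> \<le> \<eta>"
      using approx[OF on] g by blast
    have "{i \<in> {1..M}. g i \<in> hit_set d \<tau> x' u'}
      \<subseteq> {i \<in> W_set d M g \<tau> x. 1 / (2 * sqrt (real d)) \<le> inner_vec d (g i) u}"
    proof
      fix i assume "i \<in> {i \<in> {1..M}. g i \<in> hit_set d \<tau> x' u'}"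
      then have i: "i \<in> {1..M}"
        and X: "- (3 * \<tau> / 4) \<le> inner_vec d (g i) x'" "inner_vec d (g i) x' \<le> - (\<tau> / 4)"
        and U: "1 / sqrt (real d) \<le> inner_vec d (g i) u'"
        by (auto simp: hit_set_def)
      have "1 / sqrt (real d) - 1 / (2 * sqrt (real d)) = 1 / (2 * sqrt (real d))"
        using d by (simp add: field_simps)
      then show "i \<in> {i \<in> W_set d M g \<tau> x. 1 / (2 * sqrt (real d)) \<le> inner_vec d (g i) u}"
        using i X U ap[OF i] \<eta>\<tau> \<eta>d \<tau>0 unfolding W_set_def by (simp add: abs_le_iff)
    qed
    then have "card {i \<in> {1..M}. g i \<in> hit_set d \<tau> x' u'}
      \<le> card {i \<in> W_set d M g \<tau> x. 1 / (2 * sqrt (real d)) \<le> inner_vec d (g i) u}"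
      by (intro card_mono) (auto simp: W_set_def)
    then show ?thesis using hit[OF g q] by linarith
  qed
  have upper: "real (card (W_set d M g \<tau> x)) < 9 * \<mu>" if g: "g \<in> E" and x: "inner_vec d x x = 1" for g x
  proof -
    obtain u where on: "orthonormal_pair d x u" using orthonormal_pair_exists[OF d x] by blast
    obtain x' u' where q: "(x', u') \<in> N" and ap: "\<And>i. i \<in> {1..M} \<Longrightarrow>
      \<bar>inner_vec d (g i) x - inner_vec d (g i) x'\<bar> \<le> \<eta> \<and> \<bar>inner_vec d (g i) u - inner_vec d (g i) u'\<bar> \<le> \<eta>"
      using approx[OF on] g by blast
    have "g \<in> space G" using sets.sets_into_space[OF E(1)] g by blast
    then have sp: "g i \<in> space (gaussian_vec d)" if "i \<in> {1..M}" for i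
      using that by (auto simp: G_def space_PiM)
    have "W_set d M g \<tau> x \<subseteq> {i \<in> {1..M}. g i \<in> slab_set d \<tau> x'}"
    proof
      fix i assume "i \<in> W_set d M g \<tau> x"
      then have i: "i \<in> {1..M}" and X: "- \<tau> < inner_vec d (g i) x" "inner_vec d (g i) x < 0"
        by (auto simp: W_set_def)
      show "i \<in> {i \<in> {1..M}. g i \<in> slab_set d \<tau> x'}"
        using i X ap[OF i] sp[OF i] \<eta>\<tau> \<tau>0 unfolding slab_set_def by (simp add: abs_le_iff)
    qed
    then have "card (W_set d M g \<tau> x) \<le> card {i \<in> {1..M}. g i \<in> slab_set d \<tau> x'}"
      by (intro card_mono) auto
    then show ?thesis using slab[OF g q] by linarith
  qed
  show thesis
  proof (rule that[OF E(1) _ lower upper])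
    have "real (card N) * (exp (- hit_const * \<mu> / 4) + exp (- 3 * \<mu>))
      \<le> exp (14 * real d * ln (real M)) * (exp (- hit_const * \<mu> / 4) + exp (- 3 * \<mu>))"
      by (intro mult_right_mono cardN) simp
    then show "measure G E \<ge> 1 - 2 * real M * real d * exp (- 3 * real d * (real M)\<^sup>2 / 8)
       - exp (14 * real d * ln (real M)) * (exp (- hit_const * \<mu> / 4) + exp (- 3 * \<mu>))"
      using E(2) by linarith
  qed
qed

section \<open>Choice of the constants\<close>

lemma ln_ge_half: "n \<ge> 2 \<Longrightarrow> ln (real n) \<ge> 1 / 2"
  using ln2_ge_two_thirds ln_le_cancel_iff[of 2 "real n"] by linarith

text \<open>
  With \<open>y = d M\<^sup>2 / 8\<close> the left side is \<open>2 M d exp (- 3 y)\<close>. One factor \<open>exp (- y)\<close> absorbs \<open>2 M d\<close>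
  and the other two are at most \<open>exp (- d ln d)\<close>.
\<close>

lemma coordinate_tail_estimate:
  assumes d: "d \<ge> 1" and M: "M \<ge> 6" "d \<le> (M::nat)"
  shows "2 * real M * real d * exp (- 3 * real d * (real M)\<^sup>2 / 8) \<le> 3 * exp (- real d * ln (real d))"
proof -
  define y where "y = real d * (real M)\<^sup>2 / 8"
  have "real M * real d * 16 \<le> real M * real d * (3 * real M)"
    using M by (intro mult_left_mono) auto
  then have "2 * real M * real d \<le> 3 * y"
    by (simp add: y_def power2_eq_square algebra_simps)
  also have "\<dots> \<le> 3 * exp y" using exp_ge_add_one_self[of y] by linarith
  finally have 1: "2 * real M * real d \<le> 3 * exp y" .
  have "ln (real d) \<le> real d" using ln_le_minus_one[of "real d"] d by simp
  also have "\<dots> \<le> real M" using M by simp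
  also have "\<dots> \<le> (real M)\<^sup>2 / 4" using M by (simp add: power2_eq_square)
  finally have "real d * ln (real d) \<le> 2 * y"
    using mult_left_mono[of "ln (real d)" "(real M)\<^sup>2 / 4" "real d"] by (simp add: y_def)
  then have 2: "exp y * exp (- 3 * y) \<le> exp (- real d * ln (real d))"
    by (simp add: exp_add[symmetric])
  have "2 * real M * real d * exp (- 3 * real d * (real M)\<^sup>2 / 8) = 2 * real M * real d * exp (- 3 * y)"
    by (simp add: y_def)
  also have "\<dots> \<le> 3 * exp y * exp (- 3 * y)" using 1 by (rule mult_right_mono) simp
  also have "\<dots> \<le> 3 * exp (- real d * ln (real d))" using 2 by simp
  finally show ?thesis .
qed

text \<open>
  The value of \<open>C2\<close> is chosen so that the expected number of hits is at least \<open>120 D\<close>. Then at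
  most \<open>30 D\<close> hits occur with probability at most \<open>exp (- 30 D)\<close>, and \<open>30 D \<ge> 15 d ln M\<close> beats the
  size \<open>exp (14 d ln M)\<close> of the net. The hypothesis \<open>C2 * D \<le> M\<close> says that the slab is at most one
  standard deviation wide.
\<close>

proposition sign_pattern_event:
  fixes C2 :: real and d M :: nat
  defines "C2 \<equiv> 120 / hit_const"
    and "D \<equiv> real d * ln (real d) * ln (real M)"
    and "G \<equiv> \<Pi>\<^sub>M i\<in>{1..M}. gaussian_vec d"
  defines "\<tau> \<equiv> C2 * (sqrt (real d) * ln (real d) * ln (real M) / real M)"
  assumes d: "d \<ge> 2" and M: "M \<ge> 2" and big: "C2 * D \<le> real M"
  obtains E where "E \<in> sets G"
    "measure G E \<ge> 1 - 3 * exp (- real d * ln (real d)) - 2 * exp (- real d * ln (real M))"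
    "\<And>g x. g \<in> E \<Longrightarrow> inner_vec d x x = 1 \<Longrightarrow> 30 * D \<le> real (card (W_set d M g \<tau> x))"
    "\<And>g x. g \<in> E \<Longrightarrow> inner_vec d x x = 1 \<Longrightarrow> real (card (W_set d M g \<tau> x)) \<le> 9 * C2 * D"
    "\<And>g x y. g \<in> E \<Longrightarrow> inner_vec d x x = 1 \<Longrightarrow> inner_vec d y y = 1 \<Longrightarrow>
      \<forall>i \<in> W_set d M g \<tau> x. sgn (inner_vec d (g i) x) = sgn (inner_vec d (g i) y) \<Longrightarrow>
      L2_set (\<lambda>j. x j - y j) {..<d} \<le> 4 * C2 * (D / real M)"
proof -
  have C2: "C2 \<ge> 120" "hit_const * C2 = 120"
    using hit_const_bounds by (simp_all add: C2_def field_simps)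
  have lnd: "ln (real d) \<ge> 1 / 2" and lnM: "ln (real M) \<ge> 1 / 2"
    using d M by (simp_all only: ln_ge_half)
  have "1 / 2 * (1 / 2) \<le> ln (real d) * ln (real M)" using lnd lnM by (intro mult_mono) auto
  then have "real d * (1 / 4) \<le> real d * (ln (real d) * ln (real M))" by (intro mult_left_mono) auto
  then have D4: "real d / 4 \<le> D" by (simp add: D_def mult.assoc)
  have D0: "D > 0" using D4 d by simp
  have "120 * D \<le> C2 * D" using C2 D0 by (intro mult_right_mono) auto
  then have "30 * real d \<le> real M" using D4 big by linarith
  then have dM: "d \<le> M" and M6: "M \<ge> 6" using d by linarith+
  have M0: "real M > 0" using M by simp
  have s: "sqrt (real d) * \<tau> = C2 * D / real M"
    unfolding \<tau>_def D_def by (simp add: field_simps)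
  have s1: "sqrt (real d) * \<tau> \<le> 1" unfolding s using big M0 by simp
  have \<mu>: "sqrt (real d) * \<tau> * real M = C2 * D" unfolding s using M0 by simp
  have \<tau>M: "1 / real M \<le> \<tau>"
  proof -
    have "1 * (1 / 2 * (1 / 2)) \<le> sqrt (real d) * (ln (real d) * ln (real M))"
      using lnd lnM d by (intro mult_mono) auto
    then have "120 * (1 / 4) \<le> C2 * (sqrt (real d) * ln (real d) * ln (real M))"
      using C2(1) by (intro mult_mono) (auto simp: mult.assoc)
    then show ?thesis using M0 by (simp add: \<tau>_def divide_right_mono)
  qed
  have \<tau>0: "\<tau> > 0" using \<tau>M M0 by (smt (verit) divide_pos_pos)
  have M3: "M \<ge> 3" using M6 by simp
  have hc: "hit_const * (C2 * D) = 120 * D" using C2(2) by (simp add: mult.assoc[symmetric])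
  obtain E where E: "E \<in> sets G"
    "measure G E \<ge> 1 - 2 * real M * real d * exp (- 3 * real d * (real M)\<^sup>2 / 8)
       - exp (14 * real d * ln (real M)) * (exp (- hit_const * (C2 * D) / 4) + exp (- 3 * (C2 * D)))"
    and lo: "\<And>g x u. g \<in> E \<Longrightarrow> orthonormal_pair d x u \<Longrightarrow>
      hit_const * (C2 * D) / 4 < real (card {i \<in> W_set d M g \<tau> x. 1 / (2 * sqrt (real d)) \<le> inner_vec d (g i) u})"
    and up: "\<And>g x. g \<in> E \<Longrightarrow> inner_vec d x x = 1 \<Longrightarrow> real (card (W_set d M g \<tau> x)) < 9 * (C2 * D)"
    by (rule uniform_slab_counts[OF d M3 dM \<tau>M s1, unfolded \<mu>, folded G_def]) (auto intro: that)
  show thesis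
  proof (rule that[OF E(1)])
    have "15 * (real d * ln (real M)) \<le> 30 * D"
      using mult_right_mono[OF lnd, of "real d * ln (real M)"] lnM by (simp add: D_def ac_simps)
    moreover have "30 * D \<le> 3 * (C2 * D)" using \<open>120 * D \<le> C2 * D\<close> D0 by linarith
    ultimately have "- hit_const * (C2 * D) / 4 \<le> - 15 * (real d * ln (real M))"
      "- 3 * (C2 * D) \<le> - 15 * (real d * ln (real M))"
      unfolding mult_minus_left hc by linarith+
    then have "exp (- hit_const * (C2 * D) / 4) \<le> exp (- 15 * (real d * ln (real M)))"
      "exp (- 3 * (C2 * D)) \<le> exp (- 15 * (real d * ln (real M)))"
      by (simp_all only: exp_le_cancel_iff)
    then have "exp (14 * real d * ln (real M)) * (exp (- hit_const * (C2 * D) / 4) + exp (- 3 * (C2 * D)))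
      \<le> exp (14 * real d * ln (real M)) * (2 * exp (- 15 * (real d * ln (real M))))"
      by (intro mult_left_mono[OF _ exp_ge_zero]) linarith
    also have "\<dots> = 2 * exp (- real d * ln (real M))"
      by (simp add: exp_add[symmetric])
    finally show "measure G E \<ge> 1 - 3 * exp (- real d * ln (real d)) - 2 * exp (- real d * ln (real M))"
      using E(2) coordinate_tail_estimate[OF _ M6 dM] d by linarith
  next
    fix g x assume g: "g \<in> E" and x: "inner_vec d x x = 1"
    obtain u where u: "orthonormal_pair d x u" using orthonormal_pair_exists[OF d x] by blast
    have "card {i \<in> W_set d M g \<tau> x. 1 / (2 * sqrt (real d)) \<le> inner_vec d (g i) u} \<le> card (W_set d M g \<tau> x)"
      by (intro card_mono) (auto simp: W_set_def)
    then show "30 * D \<le> real (card (W_set d M g \<tau> x))" using lo[OF g u] hc by linarith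
    show "real (card (W_set d M g \<tau> x)) \<le> 9 * C2 * D" using up[OF g x] by simp
    fix y assume y: "inner_vec d y y = 1"
      and agree: "\<forall>i \<in> W_set d M g \<tau> x. sgn (inner_vec d (g i) x) = sgn (inner_vec d (g i) y)"
    have wit: "\<exists>i\<in>W_set d M g \<tau> x. - \<tau> < inner_vec d (g i) x \<and> inner_vec d (g i) x < 0
        \<and> 1 / (2 * sqrt (real d)) \<le> inner_vec d (g i) u" if "orthonormal_pair d x u" for u
    proof -
      have "real (card {i \<in> W_set d M g \<tau> x. 1 / (2 * sqrt (real d)) \<le> inner_vec d (g i) u}) > 0"
        using lo[OF g that] hc D0 by linarith
      then have "{i \<in> W_set d M g \<tau> x. 1 / (2 * sqrt (real d)) \<le> inner_vec d (g i) u} \<noteq> {}" by force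
      then show ?thesis by (auto simp: W_set_def)
    qed
    have "L2_set (\<lambda>j. x j - y j) {..<d} \<le> 2 * (\<tau> / (1 / (2 * sqrt (real d))))"
      using d by (intro sign_agreement_imp_close[OF d x y _ wit agree[rule_format]]) auto
    also have "\<dots> = 4 * (sqrt (real d) * \<tau>)" by simp
    also have "\<dots> = 4 * C2 * (D / real M)" unfolding s by simp
    finally show "L2_set (\<lambda>j. x j - y j) {..<d} \<le> 4 * C2 * (D / real M)" .
  qed
qed

theorem corollaryV1:
  "\<exists>C0 C1 C2 C3 C4 C5 c c' :: real.
     C0 > 0 \<and> C1 > 0 \<and> C2 > 0 \<and> C3 > 0 \<and> C4 > 0 \<and> C5 > 0 \<and> c > 0 \<and> c' > 0 \<and>
     (\<forall>d M :: nat. d \<ge> 1 \<longrightarrow> M \<ge> 2 \<longrightarrow>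
        real M / ln (real M) \<ge> C0 * real d * ln (real d) \<longrightarrow>
        nat \<lceil>C1 * real d * ln (real d)\<rceil> \<le> M \<and>
        (\<forall>p :: nat set pmf.
           set_pmf p \<subseteq> {V. V \<subseteq> {1..M} \<and> card V = nat \<lceil>C1 * real d * ln (real d)\<rceil>} \<longrightarrow>
           (let \<tau> = C2 * (sqrt (real d) * ln (real d) * ln (real M) / real M);
                P = sample_space d M p
            in \<exists>E \<in> sets P.
                 measure P E \<ge> 1 - 3 * exp (- c * real d * ln (real d))
                                 - 2 * exp (- c' * real d * ln (real M)) \<and>
                 (\<forall>(g, V) \<in> E. \<forall>x \<in> unit_sphere d.
                    C3 * real d * ln (real d) * ln (real M) \<le> real (card (S_set d M g V \<tau> x)) \<and>
                    real (card (S_set d M g V \<tau> x)) \<le> C4 * real d * ln (real d) * ln (real M) \<and>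
                    (\<forall>y \<in> unit_sphere d.
                       (\<forall>i \<in> S_set d M g V \<tau> x.
                          sgn (inner_vec d (g i) x) = sgn (inner_vec d (g i) y)) \<longrightarrow>
                       L2_set (\<lambda>j. x j - y j) {..<d}
                         \<le> C5 * real d * ln (real d) * ln (real M)
                            / sqrt ((real M)\<^sup>2
                                + (real d)\<^sup>2 * (ln (real d))\<^sup>2 * (ln (real M))\<^sup>2))))))"
proof -
  define C2 where "C2 = 120 / hit_const"
  have C2: "C2 \<ge> 120" using hit_const_bounds by (simp add: C2_def field_simps)
  show ?thesis
  proof (rule exI[of _ C2], rule exI[of _ 1], rule exI[of _ C2], rule exI[of _ 30],
      rule exI[of _ "9 * C2 + 4"], rule exI[of _ "8 * C2"], rule exI[of _ 1], rule exI[of _ 1],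
      intro conjI allI impI)
    fix d M :: nat
    assume d1: "d \<ge> 1" and M: "M \<ge> 2" and big: "real M / ln (real M) \<ge> C2 * real d * ln (real d)"
    define D where "D = real d * ln (real d) * ln (real M)"
    define V0 where "V0 = nat \<lceil>1 * real d * ln (real d)\<rceil>"
    have lnM: "ln (real M) \<ge> 1 / 2"
      using M by (rule ln_ge_half)
    have CD: "C2 * D \<le> real M"
      using mult_right_mono[OF big, of "ln (real M)"] lnM by (simp add: D_def ac_simps)
    have ld0: "real d * ln (real d) \<ge> 0" using d1 by simp
    have V0: "real V0 \<le> real d * ln (real d) + 1" unfolding V0_def using ld0 by simp
    \<comment> \<open>The set \<open>V\<close> adds at most \<open>4 D\<close> indices: \<open>D\<close> is at least half of \<open>d ln d\<close>, which is at least 1.\<close>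
    have V0_D: "real V0 \<le> 4 * D" if d: "d \<ge> 2"
    proof -
      have "ln (real d) \<ge> 1 / 2" using d by (rule ln_ge_half)
      then have "2 * (1 / 2) \<le> real d * ln (real d)" using d by (intro mult_mono) auto
      moreover have "real d * ln (real d) * (1 / 2) \<le> D"
        unfolding D_def using lnM ld0 by (intro mult_left_mono) auto
      ultimately show ?thesis using V0 by linarith
    qed
    show "V0 \<le> M"
    proof (cases "d = 1")
      case True
      then show ?thesis by (simp add: V0_def)
    next
      case False
      then have d: "d \<ge> 2" using d1 by simp
      have "0 \<le> D" using V0_D[OF d] by linarith
      then have "4 * D \<le> C2 * D" using C2 by (intro mult_right_mono) auto
      then show ?thesis using V0_D[OF d] CD by linarith
    qed
    fix p :: "nat set pmf"
    assume p: "set_pmf p \<subseteq> {V. V \<subseteq> {1..M} \<and> card V = V0}"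
    define \<tau> where "\<tau> = C2 * (sqrt (real d) * ln (real d) * ln (real M) / real M)"
    define G where "G = (\<Pi>\<^sub>M i\<in>{1..M}. gaussian_vec d)"
    define P where "P = sample_space d M p"
    have P: "P = G \<Otimes>\<^sub>M measure_pmf p" by (simp add: P_def G_def sample_space_def)
    have "\<exists>E \<in> sets P.
                 measure P E \<ge> 1 - 3 * exp (- 1 * real d * ln (real d))
                                 - 2 * exp (- 1 * real d * ln (real M)) \<and>
                 (\<forall>(g, V) \<in> E. \<forall>x \<in> unit_sphere d.
                    30 * real d * ln (real d) * ln (real M) \<le> real (card (S_set d M g V \<tau> x)) \<and>
                    real (card (S_set d M g V \<tau> x)) \<le> (9 * C2 + 4) * real d * ln (real d) * ln (real M) \<and>
                    (\<forall>y \<in> unit_sphere d.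
                       (\<forall>i \<in> S_set d M g V \<tau> x.
                          sgn (inner_vec d (g i) x) = sgn (inner_vec d (g i) y)) \<longrightarrow>
                       L2_set (\<lambda>j. x j - y j) {..<d}
                         \<le> 8 * C2 * real d * ln (real d) * ln (real M)
                            / sqrt ((real M)\<^sup>2
                                + (real d)\<^sup>2 * (ln (real d))\<^sup>2 * (ln (real M))\<^sup>2)))"
    proof (cases "d = 1")
      case True
      \<comment> \<open>Here \<open>ln d = 0\<close>: the required probability is negative and the empty event suffices.\<close>
      then show ?thesis by (intro bexI[of _ "{}"]) (simp_all add: order_trans[OF _ exp_ge_zero])
    next
      case False
      then have d: "d \<ge> 2" using d1 by simp
      have pG: "prob_space G" unfolding G_def by (intro prob_space_PiM prob_space_gaussian_vec[OF d1])
      obtain E where E: "E \<in> sets G"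
        "measure G E \<ge> 1 - 3 * exp (- real d * ln (real d)) - 2 * exp (- real d * ln (real M))"
        and lo: "\<And>g x. g \<in> E \<Longrightarrow> inner_vec d x x = 1 \<Longrightarrow> 30 * D \<le> real (card (W_set d M g \<tau> x))"
        and up: "\<And>g x. g \<in> E \<Longrightarrow> inner_vec d x x = 1 \<Longrightarrow> real (card (W_set d M g \<tau> x)) \<le> 9 * C2 * D"
        and close: "\<And>g x y. g \<in> E \<Longrightarrow> inner_vec d x x = 1 \<Longrightarrow> inner_vec d y y = 1 \<Longrightarrow>
          \<forall>i \<in> W_set d M g \<tau> x. sgn (inner_vec d (g i) x) = sgn (inner_vec d (g i) y) \<Longrightarrow>
          L2_set (\<lambda>j. x j - y j) {..<d} \<le> 4 * C2 * (D / real M)"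
        by (rule sign_pattern_event[OF d M, folded C2_def D_def, OF CD, folded \<tau>_def G_def])
          (rule that; assumption)
      \<comment> \<open>The admissible values of the index set have probability 1.\<close>
      define F where "F = E \<times> {V. V \<subseteq> {1..M} \<and> card V = V0}"
      have F: "F \<in> sets P" unfolding F_def P using E(1) by (intro pair_measureI) auto
      have mF: "measure P F = measure G E"
      proof -
        have "measure_pmf.prob p {V. V \<subseteq> {1..M} \<and> card V = V0} = 1"
          using p by (simp add: measure_pmf.prob_eq_1 AE_measure_pmf_iff subset_iff)
        then show ?thesis
          using measure_pmf.emeasure_pair_measure_Times[OF E(1), of "{V. V \<subseteq> {1..M} \<and> card V = V0}" p]
          by (simp add: F_def P measure_def enn2real_mult)
      qed
      have counts: "30 * D \<le> real (card (S_set d M g V \<tau> x)) \<and>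
          real (card (S_set d M g V \<tau> x)) \<le> (9 * C2 + 4) * D"
        if "(g, V) \<in> F" "x \<in> unit_sphere d" for g V x
      proof -
        have g: "g \<in> E" and V: "V \<subseteq> {1..M}" "card V = V0" using that(1) by (auto simp: F_def)
        have x: "inner_vec d x x = 1" using that(2) by (rule unit_sphere_inner)
        have "finite V" using V(1) by (rule finite_subset) simp
        then have "card (W_set d M g \<tau> x) \<le> card (S_set d M g V \<tau> x)"
          unfolding S_set_def by (intro card_mono) (auto simp: W_set_def)
        moreover have "card (S_set d M g V \<tau> x) \<le> card (W_set d M g \<tau> x) + V0"
          unfolding S_set_def V(2)[symmetric] by (rule card_Un_le)
        ultimately show ?thesis
          using lo[OF g x] up[OF g x] V0_D[OF d] by (simp add: algebra_simps)
      qed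
      have distance: "L2_set (\<lambda>j. x j - y j) {..<d} \<le> 8 * C2 * D / sqrt ((real M)\<^sup>2 + D\<^sup>2)"
        if "(g, V) \<in> F" and x: "x \<in> unit_sphere d" and y: "y \<in> unit_sphere d"
          and agree: "\<forall>i \<in> S_set d M g V \<tau> x. sgn (inner_vec d (g i) x) = sgn (inner_vec d (g i) y)"
        for g V x y
      proof -
        have g: "g \<in> E" using that(1) by (auto simp: F_def)
        have "L2_set (\<lambda>j. x j - y j) {..<d} \<le> 4 * C2 * (D / real M)"
          using agree by (intro close[OF g unit_sphere_inner[OF x] unit_sphere_inner[OF y]]) (auto simp: S_set_def)
        also have "\<dots> = 8 * C2 * D / (2 * real M)" by simp
        also have "\<dots> \<le> 8 * C2 * D / sqrt ((real M)\<^sup>2 + D\<^sup>2)"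
        proof (rule divide_left_mono)
          \<comment> \<open>As \<open>D \<le> C2 D \<le> M\<close>, the denominator of the claim is comparable with \<open>M\<close>.\<close>
          have D0: "D \<ge> 0" using V0_D[OF d] by linarith
          then have "1 * D \<le> C2 * D" using C2 by (intro mult_right_mono) auto
          then have "D\<^sup>2 \<le> (real M)\<^sup>2" using CD D0 by (intro power_mono) auto
          then have "(real M)\<^sup>2 + D\<^sup>2 \<le> (2 * real M)\<^sup>2"
            unfolding four_x_squared[symmetric] using zero_le_power2[of "real M"] by linarith
          then show "sqrt ((real M)\<^sup>2 + D\<^sup>2) \<le> 2 * real M"
            by (intro real_le_lsqrt) auto
          show "0 \<le> 8 * C2 * D" using C2 D0 by simp
          show "0 < 2 * real M * sqrt ((real M)\<^sup>2 + D\<^sup>2)" using M by (simp add: add_pos_nonneg)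
        qed
        finally show ?thesis .
      qed
      have sq: "(real d)\<^sup>2 * (ln (real d))\<^sup>2 * (ln (real M))\<^sup>2 = D\<^sup>2"
        by (simp add: D_def power_mult_distrib)
      have lin: "C * real d * ln (real d) * ln (real M) = C * D" for C
        by (simp add: D_def mult.assoc)
      have "\<forall>(g, V) \<in> F. \<forall>x \<in> unit_sphere d.
          30 * D \<le> real (card (S_set d M g V \<tau> x)) \<and>
          real (card (S_set d M g V \<tau> x)) \<le> (9 * C2 + 4) * D \<and>
          (\<forall>y \<in> unit_sphere d.
             (\<forall>i \<in> S_set d M g V \<tau> x. sgn (inner_vec d (g i) x) = sgn (inner_vec d (g i) y)) \<longrightarrow>
             L2_set (\<lambda>j. x j - y j) {..<d} \<le> 8 * C2 * D / sqrt ((real M)\<^sup>2 + D\<^sup>2))"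
        using counts distance by blast
      then show ?thesis
        unfolding sq lin using E(2) by (intro bexI[OF _ F] conjI) (simp_all only: mF mult_minus_left mult_1_left)
    qed
    then show "let \<tau> = C2 * (sqrt (real d) * ln (real d) * ln (real M) / real M);
                P = sample_space d M p
            in \<exists>E \<in> sets P.
                 measure P E \<ge> 1 - 3 * exp (- 1 * real d * ln (real d))
                                 - 2 * exp (- 1 * real d * ln (real M)) \<and>
                 (\<forall>(g, V) \<in> E. \<forall>x \<in> unit_sphere d.
                    30 * real d * ln (real d) * ln (real M) \<le> real (card (S_set d M g V \<tau> x)) \<and>
                    real (card (S_set d M g V \<tau> x)) \<le> (9 * C2 + 4) * real d * ln (real d) * ln (real M) \<and>
                    (\<forall>y \<in> unit_sphere d.
                       (\<forall>i \<in> S_set d M g V \<tau> x.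
                          sgn (inner_vec d (g i) x) = sgn (inner_vec d (g i) y)) \<longrightarrow>
                       L2_set (\<lambda>j. x j - y j) {..<d}
                         \<le> 8 * C2 * real d * ln (real d) * ln (real M)
                            / sqrt ((real M)\<^sup>2
                                + (real d)\<^sup>2 * (ln (real d))\<^sup>2 * (ln (real M))\<^sup>2)))"
      unfolding Let_def \<tau>_def P_def .
  qed (use C2 in auto)
qed

end
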